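(* Let $p \in (0,1)$ and let $M = (M(t))_{t \ge 0}$ be a continuous real-valued local martingale with $M(0)=0$. Then $$ \mathbf{E}\Big[\big(\sup_{t \ge 0} M(t)\big)^p\Big] \le c_p\, \mathbf{E}\Big[\big(-\inf_{t \ge 0} M(t)\big)^p\Big], $$ where $$ c_p := \min\Big\{4, \frac 1p\Big\}\, \frac{\pi p}{\sin(\pi p)}. $$
   Context: The local martingale $M$ is defined on a filtered probability space, and $\mathbf{E}$ denotes expectation. Since $M(0)=0$, both $\sup_{t\ge 0} M(t)$ and $-\inf_{t\ge 0}M(t)$ take values in $[0,\infty]$. Both sides of the inequality are elements of $[0,\infty]$ (with $\infty^p=\infty$). *)

theory Defs
  imports "HOL-Probability.Probability"
begin

text \<open>
  Time is \<open>[0, \<infinity>)\<close>, rendered as the nonnegative reals: values of a filtration or a process at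
  negative times are irrelevant. Neither completeness nor right-continuity of the filtration is
  required.
\<close>

locale filtered_prob_space = prob_space P for P :: "'a measure" +
  fixes F :: "real \<Rightarrow> 'a measure"
  assumes subalgebra_F: "0 \<le> t \<Longrightarrow> subalgebra P (F t)"
    and subalgebra_F_mono: "0 \<le> s \<Longrightarrow> s \<le> t \<Longrightarrow> subalgebra (F t) (F s)"

text \<open>
  Stopping times may take the value \<open>\<infinity>\<close>. The library predicate \<^const>\<open>stopping_time\<close> needs the values
  of a stopping time to lie in the index type of the filtration; the two notions are compared below.
\<close>

definition ext_stopping_time :: "(real \<Rightarrow> 'a measure) \<Rightarrow> ('a \<Rightarrow> ennreal) \<Rightarrow> bool" where
  "ext_stopping_time F T \<longleftrightarrow> (\<forall>t\<ge>0. Measurable.pred (F t) (\<lambda>\<omega>. T \<omega> \<le> ennreal t))"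

lemma ext_stopping_time_ennreal_iff:
  assumes "\<And>\<omega>. 0 \<le> T \<omega>"
  shows "ext_stopping_time F (\<lambda>\<omega>. ennreal (T \<omega>)) \<longleftrightarrow> stopping_time (\<lambda>t. F (max 0 t)) T"
proof -
  have 1: "(\<lambda>\<omega>. ennreal (T \<omega>) \<le> ennreal t) = (\<lambda>\<omega>. T \<omega> \<le> t)" if "0 \<le> t" for t
    using that by (simp add: ennreal_le_iff)
  have 2: "(\<lambda>\<omega>. T \<omega> \<le> t) = (\<lambda>\<omega>. False)" if "t < 0" for t
    using that assms by (meson dual_order.strict_trans1 linorder_not_le)
  have 3: "Measurable.pred (F (max 0 t)) (\<lambda>\<omega>. T \<omega> \<le> t)"
    if "\<And>u. 0 \<le> u \<Longrightarrow> Measurable.pred (F u) (\<lambda>\<omega>. T \<omega> \<le> u)" for t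
  proof (cases "0 \<le> t")
    case True
    then show ?thesis using that[of t] by (simp add: max_def)
  next
    case False
    then show ?thesis using 2[of t] by simp
  qed
  show ?thesis
    unfolding ext_stopping_time_def stopping_time_def
    using 1 3 by (metis max.absorb2)
qed

definition martingale ::
    "'a measure \<Rightarrow> (real \<Rightarrow> 'a measure) \<Rightarrow> (real \<Rightarrow> 'a \<Rightarrow> real) \<Rightarrow> bool" where
  "martingale P F X \<longleftrightarrow>
     (\<forall>t\<ge>0. X t \<in> borel_measurable (F t)) \<and>
     (\<forall>t\<ge>0. integrable P (X t)) \<and>
     (\<forall>s t. 0 \<le> s \<longrightarrow> s \<le> t \<longrightarrow> (AE \<omega> in P. real_cond_exp P (F s) (X t) \<omega> = X s \<omega>))"

definition stopped_process ::
    "(real \<Rightarrow> 'a \<Rightarrow> real) \<Rightarrow> ('a \<Rightarrow> ennreal) \<Rightarrow> real \<Rightarrow> 'a \<Rightarrow> real" where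
  "stopped_process X T t \<omega> = X (enn2real (min (ennreal t) (T \<omega>))) \<omega>"

definition local_martingale ::
    "'a measure \<Rightarrow> (real \<Rightarrow> 'a measure) \<Rightarrow> (real \<Rightarrow> 'a \<Rightarrow> real) \<Rightarrow> bool" where
  "local_martingale P F X \<longleftrightarrow>
     (\<forall>t\<ge>0. X t \<in> borel_measurable (F t)) \<and>
     (\<exists>\<tau> :: nat \<Rightarrow> 'a \<Rightarrow> ennreal.
        (\<forall>n. ext_stopping_time F (\<tau> n)) \<and>
        (AE \<omega> in P. incseq (\<lambda>n. \<tau> n \<omega>) \<and> (\<lambda>n. \<tau> n \<omega>) \<longlonglongrightarrow> \<infinity>) \<and>
        (\<forall>n. martingale P F (stopped_process X (\<tau> n))))"

text \<open>Continuity of sample paths is required almost surely only.\<close>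

definition continuous_local_martingale ::
    "'a measure \<Rightarrow> (real \<Rightarrow> 'a measure) \<Rightarrow> (real \<Rightarrow> 'a \<Rightarrow> real) \<Rightarrow> bool" where
  "continuous_local_martingale P F X \<longleftrightarrow>
     local_martingale P F X \<and> (AE \<omega> in P. continuous_on {0..} (\<lambda>t. X t \<omega>))"

text \<open>Powers on \<open>[0, \<infinity>]\<close>, meant for exponents \<open>p > 0\<close>.\<close>

definition ennpowr :: "ennreal \<Rightarrow> real \<Rightarrow> ennreal" (infixr "ennpowr" 80) where
  "x ennpowr p = (if x = \<infinity> then \<infinity> else ennreal (enn2real x powr p))"

definition c_const :: "real \<Rightarrow> real" where
  "c_const p = min 4 (1 / p) * (pi * p / sin (pi * p))"

end

theory Submission
  imports Defs
begin

text \<open>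
  Write \<open>S = sup M\<close> and \<open>I = - inf M\<close>. While \<open>M\<close> stays below \<open>x\<close>, the rate at which it reaches level
  \<open>x\<close> from a new minimum \<open>- a\<close> is \<open>da / (x + a)\<close>, which suggests
  \<open>P(S > x, I \<le> b) \<le> E[ln (1 + min I b / x)]\<close>. This tail bound follows from a pathwise inequality for
  discretely sampled paths, in which a martingale transform with weights \<open>1 / (x + i)\<close> (\<open>- i\<close> the running
  minimum) appears, up to an error that vanishes with the mesh because paths are continuous.

  Integrating against \<open>p x powr (p - 1)\<close>, the choice \<open>b \<rightarrow> \<infinity>\<close> gives the factor
  \<open>\<integral> x powr (p - 1) / (1 + x) dx = \<Gamma>(p) \<Gamma>(1 - p) = \<pi> / sin (\<pi> p)\<close>, that is, the constant with \<open>1 / p\<close>.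
  The choice \<open>b = x\<close>, together with \<open>P(I > x)\<close>, gives the factor \<open>1 + 1 / (1 - p)\<close>, which is below \<open>4\<close> for
  \<open>p < 1 / 4\<close>.
\<close>

subsection \<open>A pathwise inequality for finite sequences\<close>

text \<open>The negated running minimum, floored at 0. The floor keeps
  \<open>x + running_low m j\<close> positive for every sequence, whereas sampled paths start at 0
  only almost surely.\<close>

primrec running_low :: "(nat \<Rightarrow> real) \<Rightarrow> nat \<Rightarrow> real" where
  "running_low m 0 = max 0 (- m 0)"
| "running_low m (Suc j) = max (running_low m j) (- m (Suc j))"

definition inside :: "real \<Rightarrow> real \<Rightarrow> (nat \<Rightarrow> real) \<Rightarrow> nat \<Rightarrow> bool" where
  "inside x b m j \<longleftrightarrow> (\<forall>l\<le>j. m l < x \<and> - b \<le> m l)"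

text \<open>The derivative of \<open>ln (1 + i / x)\<close> at the running low \<open>i\<close>,
  switched off once the path has left \<open>[- b, x)\<close>. It is determined by the path up to
  index \<open>j\<close>, so it may multiply the next increment in a martingale transform.\<close>

definition weight :: "real \<Rightarrow> real \<Rightarrow> (nat \<Rightarrow> real) \<Rightarrow> nat \<Rightarrow> real" where
  "weight x b m j = (if inside x b m j then 1 / (x + running_low m j) else 0)"

text \<open>A step from \<open>inside\<close> to below \<open>- (2 * b)\<close> is longer than
  \<open>b\<close>. Any other exit through \<open>- b\<close> drops below the running low by at most
  \<open>2 * b\<close>, so step sizes enter the estimates only capped at that level.\<close>

definition overshoot :: "real \<Rightarrow> real \<Rightarrow> (nat \<Rightarrow> real) \<Rightarrow> nat \<Rightarrow> bool" where
  "overshoot x b m l \<longleftrightarrow> inside x b m l \<and> m (Suc l) < - (2 * b)"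

lemma running_low_nonneg: "0 \<le> running_low m j"
  by (induction j) auto

lemma running_low_ge: "l \<le> j \<Longrightarrow> - m l \<le> running_low m j"
  by (induction j) (auto simp: le_Suc_eq)

lemma running_low_le:
  "0 \<le> y \<Longrightarrow> (\<And>l. l \<le> j \<Longrightarrow> - m l \<le> y) \<Longrightarrow> running_low m j \<le> y"
  by (induction j) auto

lemma inside_Suc: "inside x b m (Suc j) \<longleftrightarrow> inside x b m j \<and> m (Suc j) < x \<and> - b \<le> m (Suc j)"
  unfolding inside_def by (auto simp: le_Suc_eq)

lemma weight_bounds:
  assumes "0 < x" shows "\<bar>weight x b m j\<bar> \<le> 1 / x"
  using assms running_low_nonneg[of m j] by (auto simp: weight_def frac_le)

text \<open>The graph of \<open>ln\<close> lies below its tangent at \<open>c\<close>.\<close>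

lemma ln_quotient_ge:
  fixes a c :: real
  assumes "0 < a" "0 < c"
  shows "(c - a) / c \<le> ln c - ln a"
proof -
  have "ln (a / c) \<le> a / c - 1" using assms by (intro ln_le_minus_one) auto
  then show ?thesis using assms by (simp add: ln_div diff_divide_distrib)
qed

text \<open>With \<open>\<phi> i = ln (1 + i / x)\<close> the quantity \<open>(m + i) \<phi>' i - \<phi> i\<close> changes by \<open>\<phi>' i\<close> times the
  increment of \<open>m\<close>, up to a concavity error incurred at new minima. Those errors telescope because
  they are at most a step size times the decrease of \<open>\<phi>'\<close>.\<close>

lemma pathwise_inside:
  assumes x: "0 < x" and b: "0 < b" and m0: "m 0 = 0"
    and d: "\<And>l. l < j \<Longrightarrow> min \<bar>m (Suc l) - m l\<bar> (2 * b) \<le> d"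
    and ins: "inside x b m j"
  shows "(m j + running_low m j) / (x + running_low m j) + d / (x + running_low m j)
     \<le> ln (x + running_low m j) - ln x + (\<Sum>l<j. weight x b m l * (m (Suc l) - m l)) + d / x"
  using d ins
proof (induction j)
  case 0
  then show ?case using m0 by simp
next
  case (Suc j)
  define i where "i = running_low m j"
  define i' where "i' = running_low m (Suc j)"
  have i0: "0 \<le> i" unfolding i_def by (rule running_low_nonneg)
  have ins: "inside x b m j" using Suc.prems by (simp add: inside_Suc)
  define V where "V = (\<Sum>l<j. weight x b m l * (m (Suc l) - m l))"
  have IH: "(m j + i) / (x + i) + d / (x + i) \<le> ln (x + i) - ln x + V + d / x"
    using Suc.IH[OF Suc.prems(1) ins] unfolding i_def V_def by simp
  have w: "weight x b m j = 1 / (x + i)" using ins by (simp add: weight_def i_def)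
  show ?case
  proof (cases "- m (Suc j) \<le> i")
    \<comment> \<open>Without a new minimum, the left side and the transform change by the same
      amount \<open>(m (Suc j) - m j) / (x + i)\<close>, and all other terms stand still.\<close>
    case True
    then have "running_low m (Suc j) = i" by (simp add: i_def)
    then show ?thesis using IH w x i0 by (simp add: V_def[symmetric] add_divide_distrib diff_divide_distrib)
  next
    case False
    then have i': "running_low m (Suc j) = i'" "i' = - m (Suc j)" "i < i'"
      by (simp_all add: i_def i'_def)
    have "i' \<le> b" using Suc.prems(2) i' by (simp add: inside_Suc)
    moreover have "i' - i \<le> \<bar>m (Suc j) - m j\<bar>"
      using running_low_ge[of j j m] i' by (simp add: i_def)
    \<comment> \<open>Both lows lie in \<open>[0, b]\<close>, so the drop is at most
      \<open>b\<close> and survives the cap at \<open>2 * b\<close>.\<close>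
    ultimately have D: "i' - i \<le> d" using Suc.prems(1)[of j] i0 b by (simp add: min_def split: if_splits)
    have "(i' - i) / (x + i') \<le> ln (x + i') - ln (x + i)"
      using ln_quotient_ge[of "x + i" "x + i'"] x i0 i' by simp
    \<comment> \<open>The concavity error is \<open>i' - i\<close> times the decrease of the weight,
      hence at most \<open>d\<close> times that decrease. The term \<open>d / (x + i)\<close> on the
      left side of the invariant absorbs it.\<close>
    moreover have "(i' - i - d) * (1 / (x + i) - 1 / (x + i')) \<le> 0"
      using D x i0 i'(3) by (intro mult_nonpos_nonneg) (auto simp: frac_le)
    moreover have "(m j + i) / (x + i) + (m (Suc j) - m j) / (x + i) = (i - i') / (x + i)"
      using i' by (simp add: add_divide_distrib[symmetric])
    ultimately have "d / (x + i') \<le> ln (x + i') - ln x + (V + (m (Suc j) - m j) / (x + i)) + d / x"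
      using IH by (simp add: algebra_simps diff_divide_distrib add_divide_distrib)
    then show ?thesis using w by (simp only: i'(1)) (simp add: V_def i'(2))
  qed
qed

text \<open>At the exit step the invariant of \<open>pathwise_inside\<close> is advanced with the
  old low \<open>i\<close>. Leaving through the top makes \<open>(m + i) / (x + i)\<close> at least
  1. Leaving through \<open>- b\<close> makes the left side 0 and costs the drop below
  \<open>i\<close>, divided by \<open>x\<close>: at most a second \<open>d / x\<close>, plus the
  overshoot. Later steps carry weight 0.\<close>

lemma pathwise_outside:
  assumes x: "0 < x" and b: "0 < b" and m0: "m 0 = 0"
    and d: "\<And>l. l < j \<Longrightarrow> min \<bar>m (Suc l) - m l\<bar> (2 * b) \<le> d"
    and d0: "0 \<le> d"
    and y: "\<And>l. l \<le> j \<Longrightarrow> inside x b m l \<Longrightarrow> running_low m l \<le> y"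
    and out: "\<not> inside x b m j"
  shows "(if \<forall>l\<le>j. - b \<le> m l then 1 else 0)
     \<le> ln (x + y) - ln x + (\<Sum>l<j. weight x b m l * (m (Suc l) - m l)) + 2 * d / x
        + (\<Sum>l<j. if overshoot x b m l then \<bar>m (Suc l)\<bar> else 0) / x"
  using d y out
proof (induction j)
  case 0
  then have "m 0 \<ge> x \<or> m 0 < -b" by (auto simp: inside_def)
  then show ?case using x b m0 by auto
next
  case (Suc j)
  define i where "i = running_low m j"
  have i0: "0 \<le> i" unfolding i_def by (rule running_low_nonneg)
  define V where "V = (\<Sum>l<j. weight x b m l * (m (Suc l) - m l))"
  define W where "W = (\<Sum>l<j. if overshoot x b m l then \<bar>m (Suc l)\<bar> else 0)"
  have W0: "0 \<le> W" unfolding W_def by (intro sum_nonneg) auto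
  show ?case
  proof (cases "inside x b m j")
    case False
    then have "weight x b m j = 0" "\<not> overshoot x b m j"
      by (auto simp: weight_def overshoot_def)
    moreover have "(if \<forall>l\<le>Suc j. - b \<le> m l then 1 else 0) \<le> (if \<forall>l\<le>j. - b \<le> m l then 1 else (0::real))"
      by auto
    ultimately show ?thesis using Suc.IH[OF Suc.prems(1,2) False] by simp
  next
    case True
    have IH: "(m j + i) / (x + i) + d / (x + i) \<le> ln (x + i) - ln x + V + d / x"
      using pathwise_inside[OF x b m0 Suc.prems(1) True] by (simp add: i_def V_def)
    have w: "weight x b m j = 1 / (x + i)" using True by (simp add: weight_def i_def)
    have iy: "i \<le> y" using Suc.prems(2)[OF _ True] by (simp add: i_def)
    then have lny: "ln (x + i) \<le> ln (x + y)" using x i0 by simp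
    have dx: "0 \<le> d / x" "0 \<le> d / (x + i)" using d0 x i0 by auto
    have dd: "2 * d / x = d / x + d / x" and Wx: "0 \<le> W / x" using W0 x by auto
    have split: "(m j + i) / (x + i) + (m (Suc j) - m j) / (x + i) = (m (Suc j) + i) / (x + i)"
      by (simp add: add_divide_distrib[symmetric])
    consider "x \<le> m (Suc j)" | "m (Suc j) < - b"
      using Suc.prems(3) True by (auto simp: inside_Suc not_less not_le)
    then show ?thesis
    proof cases
      case 1
      then have o: "\<not> overshoot x b m j" using x b by (auto simp: overshoot_def)
      have "1 \<le> (m (Suc j) + i) / (x + i)" using 1 x i0 by simp
      then have "1 \<le> ln (x + y) - ln x + (V + (m (Suc j) - m j) / (x + i)) + 2 * d / x + W / x"
        using IH split lny dx dd Wx by linarith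
      then show ?thesis using w o by (simp add: V_def W_def)
    next
      case 2
      have "i \<le> b" using True b unfolding i_def inside_def by (intro running_low_le) force+
      then have D0: "0 \<le> - m (Suc j) - i" using 2 by simp
      have D1: "- m (Suc j) - i \<le> \<bar>m (Suc j) - m j\<bar>"
        using running_low_ge[of j j m] by (simp add: i_def)
      \<comment> \<open>If the step is no overshoot, the drop is at most \<open>2 * b\<close>, so
        the capped bound \<open>d\<close> applies. Otherwise the drop is at most
        \<open>\<bar>m (Suc j)\<bar>\<close> because \<open>i\<close> is nonnegative.\<close>
      have "- m (Suc j) - i \<le> d + (if overshoot x b m j then \<bar>m (Suc j)\<bar> else 0)"
        using D1 Suc.prems(1)[of j] i0 d0 True b by (auto simp: overshoot_def min_def split: if_splits)
      moreover have "(- m (Suc j) - i) / (x + i) \<le> (- m (Suc j) - i) / x"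
        using D0 x i0 by (intro divide_left_mono) auto
      ultimately have "(- m (Suc j) - i) / (x + i) \<le> d / x + (if overshoot x b m j then \<bar>m (Suc j)\<bar> else 0) / x"
        using x by (smt (verit) add_divide_distrib divide_right_mono)
      moreover have "(m (Suc j) + i) / (x + i) = - ((- m (Suc j) - i) / (x + i))"
        by (simp add: minus_divide_left)
      ultimately have "0 \<le> ln (x + y) - ln x + (V + (m (Suc j) - m j) / (x + i)) + 2 * d / x
         + (W + (if overshoot x b m j then \<bar>m (Suc j)\<bar> else 0)) / x"
        using IH split lny dx dd Wx by (simp only: add_divide_distrib)
      moreover have "(if \<forall>l\<le>Suc j. - b \<le> m l then 1 else 0) = (0::real)" using 2 by force
      ultimately show ?thesis by (simp only: sum.lessThan_Suc w V_def W_def) simp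
    qed
  qed
qed

text \<open>A path that reaches \<open>x\<close> has left the interval, so
  \<open>pathwise_outside\<close> applies. For a path still inside, the left side is 0 and the
  invariant makes the right side nonnegative.\<close>

lemma pathwise_tail_bound:
  assumes x: "0 < x" and b: "0 < b" and m0: "m 0 = 0"
    and d: "\<And>l. l < K \<Longrightarrow> min \<bar>m (Suc l) - m l\<bar> (2 * b) \<le> d"
    and d0: "0 \<le> d"
    and y: "0 \<le> y" "\<And>l. l \<le> K \<Longrightarrow> - b \<le> m l \<Longrightarrow> - m l \<le> y"
  shows "(if (\<exists>l\<le>K. x \<le> m l) \<and> (\<forall>l\<le>K. - b \<le> m l) then 1 else 0)
     \<le> ln (x + y) - ln x + (\<Sum>l<K. weight x b m l * (m (Suc l) - m l)) + 2 * d / x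
        + (\<Sum>l<K. if overshoot x b m l then \<bar>m (Suc l)\<bar> else 0) / x"
    (is "?L \<le> _ + ?V + _ + ?W / x")
proof (cases "inside x b m K")
  case True
  define i where "i = running_low m K"
  have i0: "0 \<le> i" unfolding i_def by (rule running_low_nonneg)
  have "i \<le> y"
    unfolding i_def using y True by (intro running_low_le) (auto simp: inside_def)
  then have "ln (x + i) \<le> ln (x + y)" using x i0 by simp
  moreover have "(m K + i) / (x + i) + d / (x + i) \<le> ln (x + i) - ln x + ?V + d / x"
    using pathwise_inside[OF x b m0 d True] by (simp add: i_def)
  moreover have "0 \<le> (m K + i) / (x + i)"
    using running_low_ge[of K K m] x i0 by (simp add: i_def)
  moreover have "0 \<le> ?W / x" using x by (intro divide_nonneg_pos sum_nonneg) auto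
  moreover have "0 \<le> d / (x + i)" "0 \<le> d / x" using d0 x i0 by auto
  moreover have "?L = 0" using True by (force simp: inside_def)
  ultimately show ?thesis by simp
next
  case False
  have low: "running_low m l \<le> y" if "l \<le> K" "inside x b m l" for l
    using that y by (intro running_low_le) (auto simp: inside_def)
  have "?L \<le> (if \<forall>l\<le>K. - b \<le> m l then 1 else 0)" by auto
  also note pathwise_outside[OF x b m0 d d0 low False]
  finally show ?thesis .
qed

subsection \<open>Tail bounds for martingales\<close>

lemma measurable_running_low:
  assumes "\<And>l. l \<le> j \<Longrightarrow> m l \<in> borel_measurable N"
  shows "(\<lambda>\<omega>. running_low (\<lambda>l. m l \<omega>) j) \<in> borel_measurable N"
  using assms by (induction j) (auto intro!: borel_measurable_max borel_measurable_uminus)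

lemma measurable_inside:
  assumes "\<And>l. l \<le> j \<Longrightarrow> m l \<in> borel_measurable N"
  shows "Measurable.pred N (\<lambda>\<omega>. inside x b (\<lambda>l. m l \<omega>) j)"
  using assms
proof (induction j)
  case 0
  then have [measurable]: "m 0 \<in> borel_measurable N" by simp
  show ?case unfolding inside_def by simp
next
  case (Suc j)
  then have [measurable]: "m (Suc j) \<in> borel_measurable N"
    "Measurable.pred N (\<lambda>\<omega>. inside x b (\<lambda>l. m l \<omega>) j)" by auto
  show ?case unfolding inside_Suc by measurable
qed

lemma measurable_weight:
  assumes "\<And>l. l \<le> j \<Longrightarrow> m l \<in> borel_measurable N"
  shows "(\<lambda>\<omega>. weight x b (\<lambda>l. m l \<omega>) j) \<in> borel_measurable N"
proof -
  note [measurable] = measurable_running_low[of j m N, OF assms] measurable_inside[of j m N, OF assms]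
  show ?thesis unfolding weight_def by measurable
qed

lemma (in prob_space) integrable_ln_increment:
  assumes x: "0 < x" and Y[measurable]: "Y \<in> borel_measurable M"
    and Yb: "\<And>\<omega>. 0 \<le> Y \<omega> \<and> Y \<omega> \<le> (b::real)"
  shows "integrable M (\<lambda>\<omega>. ln (x + Y \<omega>) - ln x)"
proof (rule integrable_const_bound[where B="ln (x + b) - ln x"])
  have "\<bar>ln (x + Y \<omega>) - ln x\<bar> \<le> ln (x + b) - ln x" for \<omega>
  proof -
    have "ln x \<le> ln (x + Y \<omega>)" "ln (x + Y \<omega>) \<le> ln (x + b)"
      using x Yb[of \<omega>] by simp_all
    then show ?thesis by simp
  qed
  then show "AE \<omega> in M. norm (ln (x + Y \<omega>) - ln x) \<le> ln (x + b) - ln x" by simp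
qed measurable

context filtered_prob_space
begin

text \<open>A bounded factor known at time \<open>s\<close> passes through the conditional
  expectation; this gives weighted martingale increments mean zero.\<close>

lemma martingale_integral_mult:
  assumes X: "martingale P F X" and st: "0 \<le> s" "s \<le> t"
    and h[measurable]: "h \<in> borel_measurable (F s)" and C: "\<And>\<omega>. \<bar>h \<omega>\<bar> \<le> C"
  shows "integrable P (\<lambda>\<omega>. h \<omega> * X t \<omega>)"
    and "(\<integral>\<omega>. h \<omega> * X t \<omega> \<partial>P) = (\<integral>\<omega>. h \<omega> * X s \<omega> \<partial>P)"
proof -
  interpret finite_measure_subalgebra P "F s"
    by unfold_locales (use subalgebra_F st in auto)
  have int: "integrable P (X t)" using X st unfolding martingale_def by auto
  have hP[measurable]: "h \<in> borel_measurable P"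
    using measurable_from_subalg[OF subalg h] .
  have C0: "0 \<le> C" using C[of undefined] by simp
  show 1: "integrable P (\<lambda>\<omega>. h \<omega> * X t \<omega>)"
  proof (rule Bochner_Integration.integrable_bound)
    show "integrable P (\<lambda>\<omega>. C * X t \<omega>)" using int by simp
    show "AE \<omega> in P. norm (h \<omega> * X t \<omega>) \<le> norm (C * X t \<omega>)"
      using C C0 by (intro AE_I2) (auto simp: abs_mult intro!: mult_right_mono)
  qed (use int in measurable)
  have "(\<integral>\<omega>. h \<omega> * X t \<omega> \<partial>P) = (\<integral>\<omega>. h \<omega> * real_cond_exp P (F s) (X t) \<omega> \<partial>P)"
    using real_cond_exp_intg(2)[OF 1 h] int by simp
  also have "\<dots> = (\<integral>\<omega>. h \<omega> * X s \<omega> \<partial>P)"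
  proof (rule integral_cong_AE)
    show "AE \<omega> in P. h \<omega> * real_cond_exp P (F s) (X t) \<omega> = h \<omega> * X s \<omega>"
    proof -
      have "AE \<omega> in P. real_cond_exp P (F s) (X t) \<omega> = X s \<omega>"
        using X st unfolding martingale_def by blast
      then show ?thesis by eventually_elim simp
    qed
    show "(\<lambda>\<omega>. h \<omega> * X s \<omega>) \<in> borel_measurable P"
      using X st unfolding martingale_def by (intro borel_measurable_times hP borel_measurable_integrable) auto
  qed measurable
  finally show "(\<integral>\<omega>. h \<omega> * X t \<omega> \<partial>P) = (\<integral>\<omega>. h \<omega> * X s \<omega> \<partial>P)" .
qed

text \<open>The submartingale property of \<open>\<bar>X\<bar>\<close>, obtained by testing the
  martingale against the bounded \<open>F s\<close>-measurable function
  \<open>indicator B * sgn (X s)\<close>.\<close>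

lemma martingale_abs_integral_mono:
  assumes X: "martingale P F X" and st: "0 \<le> s" "s \<le> t" and B: "B \<in> sets (F s)"
  shows "(\<integral>\<omega>. indicator B \<omega> * \<bar>X s \<omega>\<bar> \<partial>P) \<le> (\<integral>\<omega>. indicator B \<omega> * \<bar>X t \<omega>\<bar> \<partial>P)"
proof -
  have [measurable]: "X s \<in> borel_measurable (F s)" "B \<in> sets (F s)"
    using X st B unfolding martingale_def by auto
  have BP: "B \<in> sets P" using B subalgebra_F[OF st(1)] by (auto simp: subalgebra_def)
  define h where "h = (\<lambda>\<omega>. indicator B \<omega> * sgn (X s \<omega>) :: real)"
  have hm: "h \<in> borel_measurable (F s)" unfolding h_def by measurable
  have hb: "\<bar>h \<omega>\<bar> \<le> 1" for \<omega> by (auto simp: h_def indicator_def sgn_real_def)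
  have int: "integrable P (X t)" using X st unfolding martingale_def by auto
  have "(\<integral>\<omega>. indicator B \<omega> * \<bar>X s \<omega>\<bar> \<partial>P) = (\<integral>\<omega>. h \<omega> * X s \<omega> \<partial>P)"
    by (intro Bochner_Integration.integral_cong) (auto simp: h_def indicator_def sgn_real_def)
  also have "\<dots> = (\<integral>\<omega>. h \<omega> * X t \<omega> \<partial>P)"
    using martingale_integral_mult(2)[OF X st hm hb] by simp
  also have "\<dots> \<le> (\<integral>\<omega>. indicator B \<omega> * \<bar>X t \<omega>\<bar> \<partial>P)"
  proof (rule integral_mono[OF martingale_integral_mult(1)[OF X st hm hb]])
    show "integrable P (\<lambda>\<omega>. indicator B \<omega> * \<bar>X t \<omega>\<bar>)"
      using integrable_real_mult_indicator[OF BP integrable_abs[OF int]] by (simp add: mult.commute)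
  qed (auto simp: h_def indicator_def sgn_real_def)
  finally show ?thesis .
qed

text \<open>In the bound below \<open>D\<close> dominates the step sizes. The jump that takes the sampled path below \<open>- b\<close> is
  not bounded; when it exceeds \<open>b\<close>, it is absorbed by the terminal value through the submartingale property
  of \<open>\<bar>X\<bar>\<close>, which yields the last term.\<close>

lemma martingale_discrete_tail:
  assumes X: "martingale P F X" and X0: "AE \<omega> in P. X 0 \<omega> = 0"
    and t: "t 0 = 0" "mono t"
    and x: "0 < x" and b: "0 < b"
    and Y[measurable]: "Y \<in> borel_measurable P" and Yb: "\<And>\<omega>. 0 \<le> Y \<omega> \<and> Y \<omega> \<le> b"
    and YX: "AE \<omega> in P. \<forall>l\<le>K. - b \<le> X (t l) \<omega> \<longrightarrow> - X (t l) \<omega> \<le> Y \<omega>"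
    and D[measurable]: "D \<in> borel_measurable P"
    and DX: "AE \<omega> in P. \<forall>l<K. \<bar>X (t (Suc l)) \<omega> - X (t l) \<omega>\<bar> \<le> D \<omega>" and D0: "\<And>\<omega>. 0 \<le> D \<omega>"
    and A: "A \<in> sets P"
    and AX: "AE \<omega> in P. \<omega> \<in> A \<longrightarrow> (\<exists>l\<le>K. x \<le> X (t l) \<omega>) \<and> (\<forall>l\<le>K. - b \<le> X (t l) \<omega>)"
  shows "prob A \<le> (\<integral>\<omega>. ln (x + Y \<omega>) - ln x \<partial>P) + 2 / x * (\<integral>\<omega>. min (D \<omega>) (2 * b) \<partial>P)
      + (\<integral>\<omega>. indicator {\<omega>. b < D \<omega>} \<omega> * \<bar>X (t K) \<omega>\<bar> \<partial>P) / x"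
proof -
  define m where "m = (\<lambda>l. X (t l))"
  have t0: "0 \<le> t l" for l using t monoD[OF t(2), of 0 l] by simp
  have mF: "m l \<in> borel_measurable (F (t k))" if "l \<le> k" for l k
  proof -
    have "subalgebra (F (t k)) (F (t l))" using that t t0 by (intro subalgebra_F_mono) (auto simp: monoD)
    moreover have "m l \<in> borel_measurable (F (t l))" using X t0 by (auto simp: martingale_def m_def)
    ultimately show ?thesis by (rule measurable_from_subalg)
  qed
  have mint: "integrable P (m l)" for l using X t0 by (auto simp: martingale_def m_def)
  have mP[measurable]: "m l \<in> borel_measurable P" for l using mint by auto
  define w where "w = (\<lambda>l \<omega>. weight x b (\<lambda>l. m l \<omega>) l)"
  have wF: "w l \<in> borel_measurable (F (t l))" for l
    unfolding w_def by (intro measurable_weight mF) auto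
  have wb: "\<bar>w l \<omega>\<bar> \<le> 1 / x" for l \<omega> unfolding w_def by (rule weight_bounds[OF x])
  define V where "V = (\<lambda>\<omega>. \<Sum>l<K. w l \<omega> * (m (Suc l) \<omega> - m l \<omega>))"
  have V: "integrable P V \<and> (\<integral>\<omega>. V \<omega> \<partial>P) = 0"
  proof -
    have "integrable P (\<lambda>\<omega>. w l \<omega> * (m (Suc l) \<omega> - m l \<omega>))
      \<and> (\<integral>\<omega>. w l \<omega> * (m (Suc l) \<omega> - m l \<omega>) \<partial>P) = 0" for l
    proof -
      have st: "t l \<le> t (Suc l)" using t(2) by (simp add: monoD)
      show ?thesis
        using martingale_integral_mult[OF X t0 st wF wb] martingale_integral_mult(1)[OF X t0 order_refl wF wb, of l]
        by (simp add: m_def right_diff_distrib)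
    qed
    then show ?thesis unfolding V_def by (simp add: Bochner_Integration.integral_sum)
  qed
  define Os where "Os = (\<lambda>l. {\<omega>\<in>space P. overshoot x b (\<lambda>l. m l \<omega>) l})"
  \<comment> \<open>An overshoot at \<open>l\<close> is decided by the value at index
    \<open>Suc l\<close>, hence the sigma-algebra at \<open>t (Suc l)\<close>. This is also the time
    from which \<open>\<bar>X\<bar>\<close> is compared with its terminal value.\<close>
  have O_F: "Os l \<in> sets (F (t (Suc l)))" for l
  proof -
    have [measurable]: "Measurable.pred (F (t (Suc l))) (\<lambda>\<omega>. inside x b (\<lambda>l. m l \<omega>) l)"
      "m (Suc l) \<in> borel_measurable (F (t (Suc l)))"
      by (intro measurable_inside mF; simp)+
    have "{\<omega>\<in>space (F (t (Suc l))). overshoot x b (\<lambda>l. m l \<omega>) l} \<in> sets (F (t (Suc l)))"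
      unfolding overshoot_def by measurable
    then show ?thesis using subalgebra_F[OF t0[of "Suc l"]] by (simp add: Os_def subalgebra_def)
  qed
  have OP[measurable]: "Os l \<in> sets P" for l
    using O_F[of l] subalgebra_F[OF t0[of "Suc l"]] by (auto simp: subalgebra_def)
  \<comment> \<open>After an overshoot the path has been below \<open>- b\<close>, so it is never
    \<open>inside\<close> again.\<close>
  have Odisj: "\<not> (\<omega> \<in> Os l \<and> \<omega> \<in> Os k)" if "l < k" for l k \<omega>
  proof
    assume "\<omega> \<in> Os l \<and> \<omega> \<in> Os k"
    then have "m (Suc l) \<omega> < - (2 * b)" "- b \<le> m (Suc l) \<omega>"
      using that by (auto simp: Os_def overshoot_def inside_def Suc_le_eq)
    then show False using b by simp
  qed
  have Oint: "integrable P (\<lambda>\<omega>. indicator (Os l) \<omega> * \<bar>m k \<omega>\<bar>)" for l k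
    using integrable_real_mult_indicator[OF OP integrable_abs[OF mint]] by (simp add: mult.commute)
  have DB[measurable]: "{\<omega>\<in>space P. b < D \<omega>} \<in> sets P" by measurable
  have Dint: "integrable P (\<lambda>\<omega>. indicator {\<omega>. b < D \<omega>} \<omega> * \<bar>m K \<omega>\<bar>)"
  proof (rule Bochner_Integration.integrable_bound[OF integrable_abs[OF mint[of K]]])
    show "AE \<omega> in P. norm (indicator {\<omega>. b < D \<omega>} \<omega> * \<bar>m K \<omega>\<bar>) \<le> norm \<bar>m K \<omega>\<bar>"
      by (auto simp: indicator_def)
  qed measurable
  \<comment> \<open>At most one summand is nonzero, and an overshooting step is longer than
    \<open>b\<close>, which forces \<open>b < D \<omega>\<close>.\<close>
  have OD: "AE \<omega> in P. (\<Sum>l<K. indicator (Os l) \<omega> * \<bar>m K \<omega>\<bar>) \<le> indicator {\<omega>. b < D \<omega>} \<omega> * \<bar>m K \<omega>\<bar>"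
    using DX
  proof eventually_elim
    case (elim \<omega>)
    show ?case
    proof (cases "\<exists>l<K. \<omega> \<in> Os l")
      case False
      then show ?thesis by simp
    next
      case True
      then obtain l where l: "l < K" "\<omega> \<in> Os l" by auto
      have eq: "(\<Sum>l<K. indicator (Os l) \<omega> * \<bar>m K \<omega>\<bar>) = (\<Sum>k\<in>{l}. indicator (Os k) \<omega> * \<bar>m K \<omega>\<bar>)"
      proof (intro sum.mono_neutral_right ballI)
        fix k assume "k \<in> {..<K} - {l}"
        then have "\<omega> \<notin> Os k" using l Odisj[of l k \<omega>] Odisj[of k l \<omega>] by (cases k l rule: linorder_cases) auto
        then show "indicator (Os k) \<omega> * \<bar>m K \<omega>\<bar> = 0" by simp
      qed (use l in auto)
      have "b < D \<omega>"
        using elim l b by (force simp: Os_def overshoot_def inside_def m_def)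
      then show ?thesis unfolding eq using l by simp
    qed
  qed
  have Wint: "(\<integral>\<omega>. (\<Sum>l<K. indicator (Os l) \<omega> * \<bar>m (Suc l) \<omega>\<bar>) \<partial>P)
      \<le> (\<integral>\<omega>. indicator {\<omega>. b < D \<omega>} \<omega> * \<bar>X (t K) \<omega>\<bar> \<partial>P)"
  proof -
    have "(\<integral>\<omega>. (\<Sum>l<K. indicator (Os l) \<omega> * \<bar>m (Suc l) \<omega>\<bar>) \<partial>P)
      = (\<Sum>l<K. \<integral>\<omega>. indicator (Os l) \<omega> * \<bar>m (Suc l) \<omega>\<bar> \<partial>P)"
      by (intro Bochner_Integration.integral_sum Oint)
    \<comment> \<open>Every overshoot value is moved to the terminal time, so that the sum can
      collapse to a single term.\<close>
    also have "\<dots> \<le> (\<Sum>l<K. \<integral>\<omega>. indicator (Os l) \<omega> * \<bar>m K \<omega>\<bar> \<partial>P)"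
      unfolding m_def using t
      by (intro sum_mono martingale_abs_integral_mono X t0 O_F) (auto simp: monoD)
    also have "\<dots> = (\<integral>\<omega>. (\<Sum>l<K. indicator (Os l) \<omega> * \<bar>m K \<omega>\<bar>) \<partial>P)"
      by (intro Bochner_Integration.integral_sum[symmetric] Oint)
    also have "\<dots> \<le> (\<integral>\<omega>. indicator {\<omega>. b < D \<omega>} \<omega> * \<bar>m K \<omega>\<bar> \<partial>P)"
      by (intro integral_mono_AE Bochner_Integration.integrable_sum Oint Dint OD)
    finally show ?thesis by (simp add: m_def)
  qed
  have Yint: "integrable P (\<lambda>\<omega>. ln (x + Y \<omega>) - ln x)"
    by (rule integrable_ln_increment[OF x Y Yb])
  have mDint: "integrable P (\<lambda>\<omega>. min (D \<omega>) (2 * b))"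
  proof (rule integrable_const_bound[where B="2 * b"])
    show "AE \<omega> in P. norm (min (D \<omega>) (2 * b)) \<le> 2 * b"
      using D0 b by (intro AE_I2) (auto simp: min_def)
  qed measurable
  have "AE \<omega> in P. indicator A \<omega> \<le> ln (x + Y \<omega>) - ln x + V \<omega> + 2 * min (D \<omega>) (2 * b) / x
      + (\<Sum>l<K. indicator (Os l) \<omega> * \<bar>m (Suc l) \<omega>\<bar>) / x"
    using X0 YX DX AX AE_space
  proof eventually_elim
    case (elim \<omega>)
    have "indicator A \<omega> \<le> (if (\<exists>l\<le>K. x \<le> m l \<omega>) \<and> (\<forall>l\<le>K. - b \<le> m l \<omega>) then 1 else (0::real))"
      using elim(4) by (auto simp: indicator_def m_def)
    also have "\<dots> \<le> ln (x + Y \<omega>) - ln x + V \<omega> + 2 * min (D \<omega>) (2 * b) / x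
        + (\<Sum>l<K. if overshoot x b (\<lambda>l. m l \<omega>) l then \<bar>m (Suc l) \<omega>\<bar> else 0) / x"
      unfolding V_def w_def
    proof (rule pathwise_tail_bound[OF x b])
      show "m 0 \<omega> = 0" using elim(1) t by (simp add: m_def)
      show "min \<bar>m (Suc l) \<omega> - m l \<omega>\<bar> (2 * b) \<le> min (D \<omega>) (2 * b)" if "l < K" for l
        using elim(3) that by (auto simp: m_def intro!: min.mono)
      show "0 \<le> min (D \<omega>) (2 * b)" "0 \<le> Y \<omega>" using D0 b Yb by auto
      show "- m l \<omega> \<le> Y \<omega>" if "l \<le> K" "- b \<le> m l \<omega>" for l using elim(2) that by (auto simp: m_def)
    qed
    also have "(\<Sum>l<K. if overshoot x b (\<lambda>l. m l \<omega>) l then \<bar>m (Suc l) \<omega>\<bar> else 0)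
       = (\<Sum>l<K. indicator (Os l) \<omega> * \<bar>m (Suc l) \<omega>\<bar>)"
      using elim(5) by (intro sum.cong) (auto simp: Os_def indicator_def)
    finally show ?case .
  qed
  moreover have "integrable P (indicator A :: 'a \<Rightarrow> real)"
    using A by (intro integrable_const_bound[where B=1]) (auto simp: indicator_def)
  ultimately have "(\<integral>\<omega>. indicator A \<omega> \<partial>P) \<le> (\<integral>\<omega>. ln (x + Y \<omega>) - ln x + V \<omega> + 2 * min (D \<omega>) (2 * b) / x
      + (\<Sum>l<K. indicator (Os l) \<omega> * \<bar>m (Suc l) \<omega>\<bar>) / x \<partial>P)"
    using A V by (intro integral_mono_AE Bochner_Integration.integrable_add Yint integrable_divide
      Bochner_Integration.integrable_mult_right mDint Bochner_Integration.integrable_sum Oint) auto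
  also have "\<dots> = (\<integral>\<omega>. ln (x + Y \<omega>) - ln x \<partial>P) + (\<integral>\<omega>. V \<omega> \<partial>P) + (\<integral>\<omega>. 2 * min (D \<omega>) (2 * b) / x \<partial>P)
      + (\<integral>\<omega>. (\<Sum>l<K. indicator (Os l) \<omega> * \<bar>m (Suc l) \<omega>\<bar>) / x \<partial>P)"
    using V by (subst Bochner_Integration.integral_add | intro refl Bochner_Integration.integrable_add Yint integrable_divide
      Bochner_Integration.integrable_mult_right mDint Bochner_Integration.integrable_sum Oint | simp only:)+
  also have "\<dots> \<le> (\<integral>\<omega>. ln (x + Y \<omega>) - ln x \<partial>P) + 2 / x * (\<integral>\<omega>. min (D \<omega>) (2 * b) \<partial>P)
      + (\<integral>\<omega>. indicator {\<omega>. b < D \<omega>} \<omega> * \<bar>X (t K) \<omega>\<bar> \<partial>P) / x"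
    using V divide_right_mono[OF Wint, of x] x by simp
  finally show ?thesis using A by simp
qed

end

section \<open>Sampling grids and the passage to continuous time\<close>

text \<open>The mesh is \<open>1 / Suc k\<close>, and index \<open>n * Suc k\<close> is exactly time
  \<open>n\<close>.\<close>

definition grid :: "nat \<Rightarrow> nat \<Rightarrow> real" where
  "grid k l = real l / real (Suc k)"

text \<open>The steps of \<open>f\<close> on \<open>grid k\<close> that start in \<open>[0, n]\<close>; their maximum is expressed through \<^const>\<open>running_low\<close>.\<close>

definition oscillation :: "(real \<Rightarrow> real) \<Rightarrow> nat \<Rightarrow> nat \<Rightarrow> real" where
  "oscillation f n k = running_low (\<lambda>l. - \<bar>f (grid k (Suc l)) - f (grid k l)\<bar>) (n * Suc k)"

lemma grid_nonneg: "0 \<le> grid k l"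
  by (simp add: grid_def)

lemma mono_grid: "mono (grid k)"
  by (auto simp: grid_def mono_def divide_right_mono)

lemma grid_end: "grid k (n * Suc k) = real n"
  by (simp add: grid_def field_simps)

lemma oscillation_tendsto_0:
  assumes f: "continuous_on {0..} f"
  shows "(\<lambda>k. oscillation f n k) \<longlonglongrightarrow> 0"
proof (rule tendstoI)
  fix e :: real assume e: "0 < e"
  \<comment> \<open>The last step counted starts at time \<open>n\<close> and may end as late as
    \<open>n + 1\<close>.\<close>
  have "uniformly_continuous_on {0..real n + 1} f"
    using f by (intro compact_uniformly_continuous) (auto intro: continuous_on_subset)
  then obtain d where d: "0 < d" "\<And>u v. u \<in> {0..real n + 1} \<Longrightarrow> v \<in> {0..real n + 1} \<Longrightarrow> dist v u < d \<Longrightarrow> dist (f v) (f u) < e / 2"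
    using e unfolding uniformly_continuous_on_def by (meson half_gt_zero)
  have "eventually (\<lambda>k. 1 / real (Suc k) < d) sequentially"
    using order_tendstoD(2)[OF LIMSEQ_inverse_real_of_nat d(1)] by (simp add: inverse_eq_divide)
  then show "\<forall>\<^sub>F k in sequentially. dist (oscillation f n k) 0 < e"
  proof eventually_elim
    case (elim k)
    have "oscillation f n k \<le> e / 2"
      unfolding oscillation_def
    proof (rule running_low_le)
      fix l assume l: "l \<le> n * Suc k"
      define h where "h = 1 / real (Suc k)"
      have h: "0 \<le> h" "h \<le> 1" "h < d" using elim by (simp_all add: h_def)
      have gS: "grid k (Suc l) = grid k l + h" by (simp add: grid_def h_def add_divide_distrib)
      have "grid k l \<le> real n" using monoD[OF mono_grid l, of k] by (simp only: grid_end)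
      then have "dist (f (grid k (Suc l))) (f (grid k l)) < e / 2"
        using h grid_nonneg[of k l] by (intro d(2)) (simp_all add: gS dist_real_def)
      then show "- (- \<bar>f (grid k (Suc l)) - f (grid k l)\<bar>) \<le> e / 2" by (simp add: dist_real_def)
    qed (use e in simp)
    then show ?case using running_low_nonneg e by (auto simp: oscillation_def)
  qed
qed

lemma oscillation_ge:
  "l < n * Suc k \<Longrightarrow> \<bar>f (grid k (Suc l)) - f (grid k l)\<bar> \<le> oscillation f n k"
  unfolding oscillation_def
  using running_low_ge[of l "n * Suc k" "\<lambda>l. - \<bar>f (grid k (Suc l)) - f (grid k l)\<bar>"] by simp

lemma stopped_process_eq:
  "0 \<le> t \<Longrightarrow> ennreal t \<le> T \<omega> \<Longrightarrow> stopped_process X T t \<omega> = X t \<omega>"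
  by (simp add: stopped_process_def min_def)

lemma continuous_on_stopped_process:
  assumes "continuous_on {0..} (\<lambda>t. X t \<omega>)"
  shows "continuous_on {0..} (\<lambda>t. stopped_process X T t \<omega>)"
proof (cases "T \<omega>")
  case (real r)
  have "continuous_on {0..} (\<lambda>t. X (min t r) \<omega>)"
    using real by (intro continuous_on_compose2[OF assms]) (auto intro!: continuous_intros)
  moreover have "stopped_process X T t \<omega> = X (min t r) \<omega>" if "t \<in> {0..}" for t
    using that real by (auto simp: stopped_process_def min_def)
  ultimately show ?thesis using continuous_on_cong by (metis (no_types, lifting))
next
  case top
  then have "stopped_process X T t \<omega> = X t \<omega>" if "t \<in> {0..}" for t
    using that by (intro stopped_process_eq) auto
  then show ?thesis using assms continuous_on_cong by (metis (no_types, lifting))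
qed

context filtered_prob_space
begin

lemma measurable_oscillation:
  assumes "\<And>t. 0 \<le> t \<Longrightarrow> X t \<in> borel_measurable P"
  shows "(\<lambda>\<omega>. oscillation (\<lambda>t. X t \<omega>) n k) \<in> borel_measurable P"
  unfolding oscillation_def
  by (intro measurable_running_low borel_measurable_uminus borel_measurable_abs borel_measurable_diff assms grid_nonneg)

text \<open>Dominated convergence in both terms: the first integrand is capped at
  \<open>2 * b\<close>, the second is dominated by the integrable
  \<open>\<bar>X (real n)\<bar>\<close>, and its indicator is eventually 0 along continuous
  paths.\<close>

lemma martingale_grid_error_tendsto_0:
  assumes X: "martingale P F X" and c: "AE \<omega> in P. continuous_on {0..} (\<lambda>t. X t \<omega>)" and b: "0 < b"
  shows "(\<lambda>k. 2 / x * (\<integral>\<omega>. min (oscillation (\<lambda>t. X t \<omega>) n k) (2 * b) \<partial>P)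
      + (\<integral>\<omega>. indicator {\<omega>. b < oscillation (\<lambda>t. X t \<omega>) n k} \<omega> * \<bar>X (real n) \<omega>\<bar> \<partial>P) / x) \<longlonglongrightarrow> 0"
proof -
  have Xi: "integrable P (X t)" if "0 \<le> t" for t using X that by (auto simp: martingale_def)
  then have Xm: "X t \<in> borel_measurable P" if "0 \<le> t" for t using that by auto
  note [measurable] = measurable_oscillation[of X, OF Xm] Xm[of "real n", simplified]
  have ind: "indicator {\<omega>. b < oscillation (\<lambda>t. X t \<omega>) n k} \<omega> * \<bar>X (real n) \<omega>\<bar>
      = (if b < oscillation (\<lambda>t. X t \<omega>) n k then \<bar>X (real n) \<omega>\<bar> else 0)" for k \<omega>
    by (simp add: indicator_def)
  have 1: "(\<lambda>k. \<integral>\<omega>. min (oscillation (\<lambda>t. X t \<omega>) n k) (2 * b) \<partial>P) \<longlonglongrightarrow> (\<integral>\<omega>. 0 \<partial>P)"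
  proof (rule integral_dominated_convergence[where w="\<lambda>_. 2 * b"])
    show "AE \<omega> in P. (\<lambda>k. min (oscillation (\<lambda>t. X t \<omega>) n k) (2 * b)) \<longlonglongrightarrow> 0"
      using c
    proof eventually_elim
      case (elim \<omega>)
      from tendsto_min[OF oscillation_tendsto_0[OF elim] tendsto_const[of "2 * b"]] b
      show ?case by simp
    qed
    show "AE \<omega> in P. norm (min (oscillation (\<lambda>t. X t \<omega>) n k) (2 * b)) \<le> 2 * b" for k
      using b running_low_nonneg by (intro AE_I2) (auto simp: oscillation_def min_def)
  qed auto
  have 2: "(\<lambda>k. \<integral>\<omega>. indicator {\<omega>. b < oscillation (\<lambda>t. X t \<omega>) n k} \<omega> * \<bar>X (real n) \<omega>\<bar> \<partial>P) \<longlonglongrightarrow> (\<integral>\<omega>. 0 \<partial>P)"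
    unfolding ind
  proof (rule integral_dominated_convergence[where w="\<lambda>\<omega>. \<bar>X (real n) \<omega>\<bar>"])
    show "AE \<omega> in P. (\<lambda>k. if b < oscillation (\<lambda>t. X t \<omega>) n k then \<bar>X (real n) \<omega>\<bar> else 0) \<longlonglongrightarrow> 0"
      using c
    proof eventually_elim
      case (elim \<omega>)
      have "eventually (\<lambda>k. oscillation (\<lambda>t. X t \<omega>) n k < b) sequentially"
        using order_tendstoD(2)[OF oscillation_tendsto_0[OF elim] b] .
      then have "eventually (\<lambda>k. (if b < oscillation (\<lambda>t. X t \<omega>) n k then \<bar>X (real n) \<omega>\<bar> else 0) = 0) sequentially"
        by eventually_elim simp
      then show ?case by (rule tendsto_eventually)
    qed
  qed (use Xi in auto)
  from tendsto_add[OF tendsto_mult[OF tendsto_const[of "2 / x"] 1] tendsto_divide[OF 2 tendsto_const[of x]]]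
  \<comment> \<open>For \<open>x = 0\<close> every term is 0 by the convention for division by
    0.\<close>
  show ?thesis by (cases "x = 0") auto
qed

text \<open>For each \<open>n\<close> the discrete bound is applied to the process stopped at
  \<open>\<tau> n\<close>, on a grid of \<open>[0, n]\<close> so fine that the error is below
  \<open>1 / Suc n\<close>. Almost every point of the tail event lies in the sampled events
  \<open>A n\<close> for all large \<open>n\<close>, and Fatou's lemma concludes.\<close>

lemma continuous_local_martingale_tail:
  assumes M: "continuous_local_martingale P F M" and M0: "AE \<omega> in P. M 0 \<omega> = 0"
    and S[measurable]: "S \<in> borel_measurable P" and SM: "AE \<omega> in P. S \<omega> = (SUP t\<in>{0..}. ennreal (M t \<omega>))"
    and I[measurable]: "I \<in> borel_measurable P" and IM: "AE \<omega> in P. I \<omega> = (SUP t\<in>{0..}. ennreal (- M t \<omega>))"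
    and x: "0 < x" and b: "0 < b"
  shows "emeasure P {\<omega>\<in>space P. ennreal x < S \<omega> \<and> I \<omega> \<le> ennreal b}
    \<le> (\<integral>\<^sup>+\<omega>. ennreal (ln (x + enn2real (min (I \<omega>) (ennreal b))) - ln x) \<partial>P)"
proof -
  from M obtain \<tau> where
    \<tau>: "AE \<omega> in P. incseq (\<lambda>n. \<tau> n \<omega>) \<and> (\<lambda>n. \<tau> n \<omega>) \<longlonglongrightarrow> \<infinity>"
    and mart: "\<And>n. martingale P F (stopped_process M (\<tau> n))"
    and cM: "AE \<omega> in P. continuous_on {0..} (\<lambda>t. M t \<omega>)"
    unfolding continuous_local_martingale_def local_martingale_def by auto
  define X where "X = (\<lambda>n. stopped_process M (\<tau> n))"
  \<comment> \<open>The cap at \<open>b\<close> comes before \<open>enn2real\<close>, which would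
    send infinity to 0.\<close>
  define Y where "Y = (\<lambda>\<omega>. enn2real (min (I \<omega>) (ennreal b)))"
  have Y[measurable]: "Y \<in> borel_measurable P" unfolding Y_def by measurable
  have Yb: "0 \<le> Y \<omega> \<and> Y \<omega> \<le> b" for \<omega>
    using b by (auto simp: Y_def enn2real_leI)
  have X: "martingale P F (X n)" for n using mart by (simp add: X_def)
  have Xm: "X n t \<in> borel_measurable P" if "0 \<le> t" for n t
    using X[of n] that by (auto simp: martingale_def)
  have cX: "AE \<omega> in P. continuous_on {0..} (\<lambda>t. X n t \<omega>)" for n
    using cM unfolding X_def by eventually_elim (rule continuous_on_stopped_process)
  have X0: "AE \<omega> in P. X n 0 \<omega> = 0" for n
    using M0 by eventually_elim (simp add: X_def stopped_process_eq)
  \<comment> \<open>Stopping cannot lower the infimum: a stopped path only takes values that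
    \<open>M\<close> takes at nonnegative times.\<close>
  have IX: "AE \<omega> in P. \<forall>n t. ennreal (- X n t \<omega>) \<le> I \<omega>"
    using IM
  proof eventually_elim
    case (elim \<omega>)
    show ?case unfolding elim X_def stopped_process_def
      by (intro allI SUP_upper) simp
  qed
  define err where "err = (\<lambda>n k. 2 / x * (\<integral>\<omega>. min (oscillation (\<lambda>t. X n t \<omega>) n k) (2 * b) \<partial>P)
      + (\<integral>\<omega>. indicator {\<omega>. b < oscillation (\<lambda>t. X n t \<omega>) n k} \<omega> * \<bar>X n (real n) \<omega>\<bar> \<partial>P) / x)"
  \<comment> \<open>The requirement \<open>k \<ge> n\<close> makes the meshes tend to 0, so that the
    grids eventually meet any given open time interval.\<close>
  have "\<exists>k\<ge>n. err n k < 1 / real (Suc n)" for n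
  proof -
    have "(\<lambda>k. err n k) \<longlonglongrightarrow> 0"
      unfolding err_def by (rule martingale_grid_error_tendsto_0[OF X cX b])
    then have "eventually (\<lambda>k. err n k < 1 / real (Suc n)) sequentially"
      by (rule order_tendstoD) simp
    then have "eventually (\<lambda>k. k \<ge> n \<and> err n k < 1 / real (Suc n)) sequentially"
      using eventually_ge_at_top by (rule eventually_conj[rotated])
    then show ?thesis by (auto simp: eventually_sequentially)
  qed
  then obtain k where k: "\<And>n. n \<le> k n" "\<And>n. err n (k n) < 1 / real (Suc n)" by metis
  define A where "A = (\<lambda>n. {\<omega>\<in>space P. I \<omega> \<le> ennreal b \<and> (\<exists>l\<le>n * Suc (k n). x \<le> X n (grid (k n) l) \<omega>)})"
  note [measurable] = Xm[OF grid_nonneg]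
  have A[measurable]: "A n \<in> sets P" for n unfolding A_def by measurable
  define c where "c = (\<integral>\<omega>. ln (x + Y \<omega>) - ln x \<partial>P)"
  have PA: "prob (A n) \<le> c + 1 / real (Suc n)" for n
  proof -
    have "prob (A n) \<le> c + 2 / x * (\<integral>\<omega>. min (oscillation (\<lambda>t. X n t \<omega>) n (k n)) (2 * b) \<partial>P)
      + (\<integral>\<omega>. indicator {\<omega>. b < oscillation (\<lambda>t. X n t \<omega>) n (k n)} \<omega> * \<bar>X n (grid (k n) (n * Suc (k n))) \<omega>\<bar> \<partial>P) / x"
      unfolding c_def
    proof (rule martingale_discrete_tail[OF X X0])
      show "grid (k n) 0 = 0" by (simp add: grid_def)
      show "AE \<omega> in P. \<forall>l\<le>n * Suc (k n). - b \<le> X n (grid (k n) l) \<omega> \<longrightarrow> - X n (grid (k n) l) \<omega> \<le> Y \<omega>"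
        using IX
      proof eventually_elim
        case (elim \<omega>)
        show ?case
        proof (intro allI impI)
          fix l assume *: "- b \<le> X n (grid (k n) l) \<omega>"
          have "ennreal (- X n (grid (k n) l) \<omega>) \<le> min (I \<omega>) (ennreal b)"
            using elim * by (auto intro!: ennreal_leI)
          then have "enn2real (ennreal (- X n (grid (k n) l) \<omega>)) \<le> Y \<omega>"
            unfolding Y_def by (rule enn2real_mono) (simp add: min_less_iff_disj)
          \<comment> \<open>A negative \<open>- X\<close> is truncated to 0 by
            \<open>ennreal\<close>; in that case the bound follows from
            \<open>0 \<le> Y \<omega>\<close>.\<close>
          then show "- X n (grid (k n) l) \<omega> \<le> Y \<omega>"
            using Yb[of \<omega>] by (cases "0 \<le> - X n (grid (k n) l) \<omega>") auto
        qed
      qed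
      show "AE \<omega> in P. \<forall>l<n * Suc (k n).
          \<bar>X n (grid (k n) (Suc l)) \<omega> - X n (grid (k n) l) \<omega>\<bar> \<le> oscillation (\<lambda>t. X n t \<omega>) n (k n)"
        by (intro AE_I2 allI impI oscillation_ge)
      show "AE \<omega> in P. \<omega> \<in> A n \<longrightarrow> (\<exists>l\<le>n * Suc (k n). x \<le> X n (grid (k n) l) \<omega>)
          \<and> (\<forall>l\<le>n * Suc (k n). - b \<le> X n (grid (k n) l) \<omega>)"
        using IX
      proof eventually_elim
        case (elim \<omega>)
        have "- b \<le> X n t \<omega>" if "\<omega> \<in> A n" for t
        proof -
          have "ennreal (- X n t \<omega>) \<le> ennreal b"
            using elim that by (auto simp: A_def intro: order_trans)
          then show ?thesis using b by (simp add: ennreal_le_iff)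
        qed
        then show ?case by (auto simp: A_def)
      qed
    qed (use x b Y Yb A mono_grid measurable_oscillation[of "X n", OF Xm] running_low_nonneg in
        \<open>auto simp: oscillation_def\<close>)
    then show ?thesis using k(2)[of n] unfolding err_def grid_end by linarith
  qed
  have lim: "AE \<omega> in P. indicator {\<omega>\<in>space P. ennreal x < S \<omega> \<and> I \<omega> \<le> ennreal b} \<omega>
     \<le> liminf (\<lambda>n. indicator (A n) \<omega> :: ennreal)"
    using SM \<tau> cM
  proof eventually_elim
    case (elim \<omega>)
    show ?case
    proof (cases "\<omega> \<in> space P \<and> ennreal x < S \<omega> \<and> I \<omega> \<le> ennreal b")
      case True
      then obtain s where s: "0 \<le> s" "x < M s \<omega>"
        using elim(1) x by (auto simp: less_SUP_iff ennreal_less_iff)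
      \<comment> \<open>By continuity a value above \<open>x\<close> persists on a time interval
        around \<open>s\<close>.\<close>
      obtain d where d: "0 < d" "\<And>u. 0 \<le> u \<Longrightarrow> \<bar>u - s\<bar> < d \<Longrightarrow> x < M u \<omega>"
      proof -
        have "\<exists>d>0. \<forall>u\<in>{0..}. dist u s < d \<longrightarrow> dist (M u \<omega>) (M s \<omega>) < M s \<omega> - x"
          using elim(3) s unfolding continuous_on_iff by auto
        then show thesis using that by (force simp: dist_real_def)
      qed
      \<comment> \<open>The margin 1 leaves room for rounding \<open>s\<close> up to the grid before
        the stopping time \<open>\<tau> n\<close> and the horizon \<open>n\<close>.\<close>
      have "eventually (\<lambda>n. ennreal (s + 1) < \<tau> n \<omega>) sequentially"
        using elim(2) by (intro order_tendstoD(1)) auto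
      moreover have "eventually (\<lambda>n. 1 / real (Suc n) < d) sequentially"
        using order_tendstoD(2)[OF LIMSEQ_inverse_real_of_nat d(1)] by (simp add: inverse_eq_divide)
      moreover have "eventually (\<lambda>n. s + 1 \<le> real n) sequentially"
        using filterlim_real_sequentially by (auto simp: filterlim_at_top)
      ultimately have "eventually (\<lambda>n. \<omega> \<in> A n) sequentially"
      proof eventually_elim
        case (elim n)
        \<comment> \<open>The first grid index at or after time \<open>s\<close>.\<close>
        define l where "l = nat \<lceil>s * real (Suc (k n))\<rceil>"
        have kn: "1 / real (Suc (k n)) \<le> 1 / real (Suc n)" using k(1)[of n] by (simp add: frac_le)
        have l1: "s * real (Suc (k n)) \<le> real l" "real l < s * real (Suc (k n)) + 1"
          using s(1) ceiling_correct[of "s * real (Suc (k n))"] unfolding l_def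
          by (simp_all add: real_nat_ceiling_ge)
        have g: "s \<le> grid (k n) l" "grid (k n) l < s + 1 / real (Suc (k n))"
          using l1 unfolding grid_def by (simp_all add: field_simps del: of_nat_Suc)
        have g1: "grid (k n) l \<le> s + 1"
          using g(2) by (smt (verit) divide_le_eq_1_pos of_nat_0_less_iff of_nat_1 of_nat_le_iff zero_less_Suc Suc_le_mono One_nat_def le0)
        have "grid (k n) l \<le> real n" using g1 elim(3) by simp
        then have "l \<le> n * Suc (k n)"
          unfolding grid_def by (simp add: pos_divide_le_eq del: of_nat_Suc flip: of_nat_mult)
        moreover have "x < M (grid (k n) l) \<omega>"
          using g kn elim(2) s(1) by (intro d(2)) auto
        moreover have "ennreal (grid (k n) l) \<le> \<tau> n \<omega>"
          using order_trans[OF ennreal_leI[OF g1] less_imp_le[OF elim(1)]] .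
        ultimately show "\<omega> \<in> A n"
          using True by (auto simp: A_def X_def stopped_process_eq grid_nonneg intro!: exI[of _ l])
      qed
      then have "eventually (\<lambda>n. (1::ennreal) \<le> indicator (A n) \<omega>) sequentially"
        by eventually_elim simp
      then have "(1::ennreal) \<le> liminf (\<lambda>n. indicator (A n) \<omega>)" by (rule Liminf_bounded)
      then show ?thesis using True by simp
    qed simp
  qed
  have "emeasure P {\<omega>\<in>space P. ennreal x < S \<omega> \<and> I \<omega> \<le> ennreal b}
    = (\<integral>\<^sup>+\<omega>. indicator {\<omega>\<in>space P. ennreal x < S \<omega> \<and> I \<omega> \<le> ennreal b} \<omega> \<partial>P)"
    by (simp add: nn_integral_indicator)
  also have "\<dots> \<le> (\<integral>\<^sup>+\<omega>. liminf (\<lambda>n. indicator (A n) \<omega>) \<partial>P)"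
    by (rule nn_integral_mono_AE[OF lim])
  also have "\<dots> \<le> liminf (\<lambda>n. \<integral>\<^sup>+\<omega>. indicator (A n) \<omega> \<partial>P)"
    by (rule nn_integral_liminf) measurable
  also have "\<dots> \<le> liminf (\<lambda>n. ennreal (c + 1 / real (Suc n)))"
    using PA by (intro Liminf_mono always_eventually allI)
      (simp add: emeasure_eq_measure ennreal_leI)
  also have "\<dots> = ennreal c"
  proof (rule lim_imp_Liminf)
    have "(\<lambda>n. c + 1 / real (Suc n)) \<longlonglongrightarrow> c + 0"
      using LIMSEQ_inverse_real_of_nat by (intro tendsto_add tendsto_const) (simp add: inverse_eq_divide)
    then show "(\<lambda>n. ennreal (c + 1 / real (Suc n))) \<longlonglongrightarrow> ennreal c" by (intro tendsto_ennrealI) simp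
  qed simp
  also have "ennreal c = (\<integral>\<^sup>+\<omega>. ennreal (ln (x + Y \<omega>) - ln x) \<partial>P)"
    unfolding c_def
  proof (rule nn_integral_eq_integral[symmetric])
    show "integrable P (\<lambda>\<omega>. ln (x + Y \<omega>) - ln x)"
      by (rule integrable_ln_increment[OF x Y Yb])
    show "AE \<omega> in P. 0 \<le> ln (x + Y \<omega>) - ln x"
    proof (rule AE_I2)
      fix \<omega> show "0 \<le> ln (x + Y \<omega>) - ln x" using x Yb[of \<omega>] by simp
    qed
  qed
  finally show ?thesis by (simp add: Y_def)
qed

end

subsection \<open>From tails to moments\<close>

lemma ennpowr_layer_cake:
  assumes p: "0 < p"
  shows "y ennpowr p = (\<integral>\<^sup>+a. (if 0 < a \<and> ennreal a < y then ennreal (p * a powr (p - 1)) else 0) \<partial>lborel)"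
proof -
  have fin: "ennreal (r powr p)
     = (\<integral>\<^sup>+a. (if 0 < a \<and> ennreal a < ennreal r then ennreal (p * a powr (p - 1)) else 0) \<partial>lborel)"
    if r: "0 \<le> r" for r
  proof -
    have "((\<lambda>a. p * a powr (p - 1)) has_integral p * (r powr (p - 1 + 1) / (p - 1 + 1))) {0..r}"
      using p r by (intro has_integral_mult_right has_integral_powr_from_0) auto
    then have "((\<lambda>a. p * a powr (p - 1)) has_integral r powr p) {0<..<r}"
      using p by (simp add: has_integral_Icc_iff_Ioo)
    from nn_integral_has_integral_lebesgue'[OF _ this] p
    have "ennreal (r powr p) = (\<integral>\<^sup>+a. ennreal (p * a powr (p - 1)) * indicator {0<..<r} a \<partial>lborel)"
      by simp
    also have "\<dots> = (\<integral>\<^sup>+a. (if 0 < a \<and> ennreal a < ennreal r then ennreal (p * a powr (p - 1)) else 0) \<partial>lborel)"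
      using r by (intro nn_integral_cong) (auto simp: indicator_def ennreal_less_iff)
    finally show ?thesis .
  qed
  show ?thesis
  proof (cases y)
    case (real r)
    then show ?thesis using fin[of r] by (simp add: ennpowr_def)
  next
    case top
    have "(\<integral>\<^sup>+a. (if 0 < a \<and> ennreal a < y then ennreal (p * a powr (p - 1)) else 0) \<partial>lborel) = \<infinity>"
      (is "?I = _")
    proof (rule ccontr)
      assume "?I \<noteq> \<infinity>"
      then obtain c where c: "0 \<le> c" "?I = ennreal c" by (cases ?I) auto
      \<comment> \<open>The level is chosen so that its \<open>p\<close>-th power is
        \<open>c + 1\<close>, which exceeds the supposed finite value \<open>c\<close>.\<close>
      have "ennreal (((c + 1) powr (1 / p)) powr p) \<le> ?I"
        using top p by (subst fin) (auto intro!: nn_integral_mono)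
      then show False using c p by (simp add: powr_powr ennreal_le_iff)
    qed
    then show ?thesis using top by (simp add: ennpowr_def)
  qed
qed

text \<open>Turns the logarithmic tail bound into an integral of the kernel
  \<open>1 / (x + a)\<close> over levels \<open>a\<close>, the form in which integrals over
  \<open>x\<close>, \<open>a\<close> and \<open>\<omega>\<close> can be interchanged.\<close>

lemma ln_increment_eq_nn_integral:
  assumes x: "0 < x" and y: "0 \<le> y"
  shows "ennreal (ln (x + y) - ln x) = (\<integral>\<^sup>+a. (if 0 < a \<and> a < y then ennreal (1 / (x + a)) else 0) \<partial>lborel)"
proof -
  have "((\<lambda>a. 1 / (x + a)) has_integral ln (x + y) - ln (x + 0)) {0..y}"
    using x y by (intro fundamental_theorem_of_calculus)
      (auto intro!: derivative_eq_intros simp flip: has_real_derivative_iff_has_vector_derivative)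
  then have "((\<lambda>a. 1 / (x + a)) has_integral ln (x + y) - ln x) {0<..<y}"
    by (simp add: has_integral_Icc_iff_Ioo)
  from nn_integral_has_integral_lebesgue'[OF _ this] x
  have "ennreal (ln (x + y) - ln x) = (\<integral>\<^sup>+a. ennreal (1 / (x + a)) * indicator {0<..<y} a \<partial>lborel)"
    by simp
  also have "\<dots> = (\<integral>\<^sup>+a. (if 0 < a \<and> a < y then ennreal (1 / (x + a)) else 0) \<partial>lborel)"
    by (intro nn_integral_cong) (auto simp: indicator_def)
  finally show ?thesis .
qed

section \<open>Integrals of the kernel through the Gamma function\<close>

text \<open>Euler's integral for \<open>Gamma q\<close> under the substitution of
  \<open>s * x\<close> for \<open>x\<close>.\<close>

lemma nn_integral_Gamma_scaled:
  fixes s q :: real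
  assumes s: "0 < s" and q: "0 < q"
  shows "(\<integral>\<^sup>+x. (if 0 < x then ennreal (x powr (q - 1) * exp (- (s * x))) else 0) \<partial>lborel)
    = ennreal (Gamma q * s powr (- q))"
proof -
  define N where "N = (\<integral>\<^sup>+x. (if 0 < x then ennreal (x powr (q - 1) * exp (- (s * x))) else 0) \<partial>lborel)"
  have "ennreal (Gamma q) = (\<integral>\<^sup>+x. ennreal (indicator {0..} x * x powr (q - 1) / exp x) \<partial>lborel)"
    using Gamma_conv_nn_integral_real[OF q] .
  also have "\<dots> = ennreal \<bar>s\<bar> *
      (\<integral>\<^sup>+x. ennreal (indicator {0..} (0 + s * x) * (0 + s * x) powr (q - 1) / exp (0 + s * x)) \<partial>lborel)"
    using s by (intro nn_integral_real_affine) auto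
  also have "(\<integral>\<^sup>+x. ennreal (indicator {0..} (0 + s * x) * (0 + s * x) powr (q - 1) / exp (0 + s * x)) \<partial>lborel)
     = (\<integral>\<^sup>+x. ennreal (s powr (q - 1)) * (if 0 < x then ennreal (x powr (q - 1) * exp (- (s * x))) else 0) \<partial>lborel)"
  proof (rule nn_integral_cong)
    fix x :: real
    consider "0 < x" | "x = 0" | "x < 0" by linarith
    then show "ennreal (indicator {0..} (0 + s * x) * (0 + s * x) powr (q - 1) / exp (0 + s * x))
      = ennreal (s powr (q - 1)) * (if 0 < x then ennreal (x powr (q - 1) * exp (- (s * x))) else 0)"
    proof cases
      case 1
      then show ?thesis using s by (simp add: powr_mult exp_minus divide_inverse mult.assoc flip: ennreal_mult)
    next
      case 3
      then have "s * x < 0" using s by (simp add: mult_pos_neg)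
      then show ?thesis using 3 by simp
    qed simp
  qed
  also have "\<dots> = ennreal (s powr (q - 1)) * N"
    unfolding N_def by (intro nn_integral_cmult) measurable
  finally have "ennreal (Gamma q) = ennreal (s powr q) * N"
    using s by (simp add: mult.assoc[symmetric] powr_diff flip: ennreal_mult)
  \<comment> \<open>Multiplication by the inverse power cancels the factor before \<open>N\<close>
    is known to be finite.\<close>
  then have "ennreal (s powr (- q)) * ennreal (Gamma q) = ennreal (s powr (- q) * s powr q) * N"
    by (simp add: ennreal_mult mult.assoc)
  also have "s powr (- q) * s powr q = 1" using s by (simp flip: powr_add)
  finally show ?thesis using q unfolding N_def[symmetric]
    by (simp add: mult.commute flip: ennreal_mult)
qed

text \<open>The complex reflection formula on the real line. At integers both sides are 0 by the
  conventions for poles and for division by 0.\<close>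

lemma Gamma_reflection_real:
  fixes p :: real
  shows "Gamma p * Gamma (1 - p) = pi / sin (pi * p)"
proof -
  have "complex_of_real (Gamma p * Gamma (1 - p)) = Gamma (of_real p) * Gamma (1 - of_real p)"
    using Gamma_complex_of_real[of "1 - p"] by (simp add: Gamma_complex_of_real)
  also have "\<dots> = of_real pi / sin (of_real (pi * p))"
    by (simp add: Gamma_reflection_complex)
  also have "\<dots> = of_real (pi / sin (pi * p))"
    by (simp only: sin_of_real of_real_divide)
  finally have "complex_of_real (Gamma p * Gamma (1 - p)) = of_real (pi / sin (pi * p))" .
  then show ?thesis by (simp only: of_real_eq_iff)
qed

text \<open>Write \<open>1 / (x + a)\<close> as the integral of \<open>exp (- (s * (x + a)))\<close>
  over \<open>s > 0\<close> and interchange. The inner integral gives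
  \<open>Gamma p * s powr (- p)\<close>, the outer one \<open>Gamma (1 - p)\<close>, and the
  reflection formula evaluates their product.\<close>

lemma nn_integral_powr_over_shift:
  fixes p a :: real
  assumes p: "0 < p" "p < 1" and a: "0 < a"
  shows "(\<integral>\<^sup>+x. (if 0 < x then ennreal (x powr (p - 1) / (x + a)) else 0) \<partial>lborel)
     = ennreal (pi / sin (pi * p) * a powr (p - 1))"
proof -
  have 1: "(if 0 < x then ennreal (x powr (p - 1) / (x + a)) else 0)
     = (\<integral>\<^sup>+s. (if 0 < x \<and> 0 < s then ennreal (x powr (p - 1) * exp (- (s * (x + a)))) else 0) \<partial>lborel)" for x
  proof (cases "0 < x")
    case True
    have "(\<integral>\<^sup>+s. (if 0 < x \<and> 0 < s then ennreal (x powr (p - 1) * exp (- (s * (x + a)))) else 0) \<partial>lborel)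
       = (\<integral>\<^sup>+s. ennreal (x powr (p - 1)) * (if 0 < s then ennreal (s powr (1 - 1) * exp (- ((x + a) * s))) else 0) \<partial>lborel)"
      using True by (intro nn_integral_cong) (auto simp: mult.commute simp flip: ennreal_mult)
    also have "\<dots> = ennreal (x powr (p - 1)) * ennreal (Gamma 1 * (x + a) powr (- 1))"
      using True a nn_integral_Gamma_scaled[of "x + a" 1] by (subst nn_integral_cmult) auto
    also have "\<dots> = ennreal (x powr (p - 1) / (x + a))"
      using True a by (simp add: powr_minus divide_inverse flip: ennreal_mult)
    finally show ?thesis using True by simp
  qed simp
  have "(\<integral>\<^sup>+x. (if 0 < x then ennreal (x powr (p - 1) / (x + a)) else 0) \<partial>lborel)
    = (\<integral>\<^sup>+s. \<integral>\<^sup>+x. (if 0 < x \<and> 0 < s then ennreal (x powr (p - 1) * exp (- (s * (x + a)))) else 0) \<partial>lborel \<partial>lborel)"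
    unfolding 1 by (rule lborel_pair.Fubini') measurable
  also have "\<dots> = (\<integral>\<^sup>+s. ennreal (Gamma p) * (if 0 < s then ennreal (s powr ((1 - p) - 1) * exp (- (a * s))) else 0) \<partial>lborel)"
  proof (rule nn_integral_cong)
    fix s :: real
    have "(\<integral>\<^sup>+x. (if 0 < x \<and> 0 < s then ennreal (x powr (p - 1) * exp (- (s * (x + a)))) else 0) \<partial>lborel)
       = (\<integral>\<^sup>+x. ennreal (exp (- (a * s))) * (if 0 < x then ennreal (x powr (p - 1) * exp (- (s * x))) else 0) \<partial>lborel)"
      if "0 < s"
      using that by (intro nn_integral_cong) (auto simp: algebra_simps simp flip: ennreal_mult exp_add)
    also have "\<dots> = ennreal (exp (- (a * s))) * ennreal (Gamma p * s powr (- p))" if "0 < s"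
      using that p by (subst nn_integral_cmult) (auto simp: nn_integral_Gamma_scaled)
    also have "\<dots> = ennreal (Gamma p) * ennreal (s powr ((1 - p) - 1) * exp (- (a * s)))"
      using p by (simp add: mult_ac flip: ennreal_mult)
    finally show "(\<integral>\<^sup>+x. (if 0 < x \<and> 0 < s then ennreal (x powr (p - 1) * exp (- (s * (x + a)))) else 0) \<partial>lborel)
      = ennreal (Gamma p) * (if 0 < s then ennreal (s powr ((1 - p) - 1) * exp (- (a * s))) else 0)"
      by (cases "0 < s") auto
  qed
  also have "\<dots> = ennreal (Gamma p) * ennreal (Gamma (1 - p) * a powr (- (1 - p)))"
    using p a by (subst nn_integral_cmult) (auto simp: nn_integral_Gamma_scaled)
  also have "\<dots> = ennreal (pi / sin (pi * p) * a powr (p - 1))"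
    using p by (simp add: Gamma_reflection_real[symmetric] mult.assoc flip: ennreal_mult)
  finally show ?thesis .
qed

text \<open>Dropping \<open>a\<close> from the denominator leaves the convergent integral of
  \<open>x powr (p - 2)\<close>. The factor \<open>1 / (1 - p)\<close> stays bounded as
  \<open>p\<close> tends to 0, unlike \<open>pi / sin (pi * p)\<close>.\<close>

lemma nn_integral_powr_over_shift_tail_le:
  fixes p a :: real
  assumes p: "0 < p" "p < 1" and a: "0 < a"
  shows "(\<integral>\<^sup>+x. (if a < x then ennreal (x powr (p - 1) / (x + a)) else 0) \<partial>lborel)
     \<le> ennreal (1 / (1 - p) * a powr (p - 1))"
proof -
  have I: "((\<lambda>x. x powr (p - 2)) has_integral - (a powr (p - 2 + 1)) / (p - 2 + 1)) {a..}"
    using p a by (intro has_integral_powr_to_inf) auto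
  have "(\<integral>\<^sup>+x. (if a < x then ennreal (x powr (p - 1) / (x + a)) else 0) \<partial>lborel)
    \<le> (\<integral>\<^sup>+x. ennreal (x powr (p - 2)) * indicator {a..} x \<partial>lborel)"
  proof (rule nn_integral_mono)
    fix x :: real
    have "x powr (p - 1) / (x + a) \<le> x powr (p - 1) / x" if "a < x"
      using that a by (intro divide_left_mono) auto
    also have "x powr (p - 1) / x = x powr (p - 2)" if "a < x"
      using that a by (simp add: powr_diff power2_eq_square)
    finally show "(if a < x then ennreal (x powr (p - 1) / (x + a)) else 0)
        \<le> ennreal (x powr (p - 2)) * indicator {a..} x"
      by (auto simp: indicator_def intro!: ennreal_leI)
  qed
  also have "\<dots> = ennreal (- (a powr (p - 2 + 1)) / (p - 2 + 1))"
    by (rule nn_integral_has_integral_lebesgue'[OF _ I]) simp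
  also have "- (a powr (p - 2 + 1)) / (p - 2 + 1) = 1 / (1 - p) * a powr (p - 1)"
    using p by (simp add: field_simps)
  finally show ?thesis .
qed

section \<open>Layer-cake formulas and the two moment bounds\<close>

text \<open>Tonelli's theorem turns a density on the levels below \<open>I\<close> into an integral
  of tail probabilities.\<close>

lemma nn_integral_layer:
  assumes "sigma_finite_measure P" and I[measurable]: "I \<in> borel_measurable P"
    and f[measurable]: "f \<in> borel_measurable borel"
  shows "(\<integral>\<^sup>+\<omega>. (\<integral>\<^sup>+a. (if 0 < a \<and> ennreal a < I \<omega> then f a else 0) \<partial>lborel) \<partial>P)
    = (\<integral>\<^sup>+a. (if 0 < a then f a * emeasure P {\<omega>\<in>space P. ennreal a < I \<omega>} else 0) \<partial>lborel)"
proof -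
  interpret P: sigma_finite_measure P by fact
  interpret pair_sigma_finite P lborel ..
  have "(\<integral>\<^sup>+\<omega>. (\<integral>\<^sup>+a. (if 0 < a \<and> ennreal a < I \<omega> then f a else 0) \<partial>lborel) \<partial>P)
    = (\<integral>\<^sup>+a. (\<integral>\<^sup>+\<omega>. (if 0 < a \<and> ennreal a < I \<omega> then f a else 0) \<partial>P) \<partial>lborel)"
    by (rule Fubini'[symmetric]) measurable
  also have "\<dots> = (\<integral>\<^sup>+a. (if 0 < a then f a * emeasure P {\<omega>\<in>space P. ennreal a < I \<omega>} else 0) \<partial>lborel)"
  proof (rule nn_integral_cong)
    fix a :: real
    have "(\<integral>\<^sup>+\<omega>. (if ennreal a < I \<omega> then f a else 0) \<partial>P)
      = (\<integral>\<^sup>+\<omega>. f a * indicator {\<omega>\<in>space P. ennreal a < I \<omega>} \<omega> \<partial>P)"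
      by (intro nn_integral_cong) (auto simp: indicator_def)
    also have "\<dots> = f a * emeasure P {\<omega>\<in>space P. ennreal a < I \<omega>}"
      by (intro nn_integral_cmult_indicator) measurable
    finally show "(\<integral>\<^sup>+\<omega>. (if 0 < a \<and> ennreal a < I \<omega> then f a else 0) \<partial>P)
        = (if 0 < a then f a * emeasure P {\<omega>\<in>space P. ennreal a < I \<omega>} else 0)"
      by (cases "0 < a") auto
  qed
  finally show ?thesis .
qed

lemma measurable_emeasure_tail:
  assumes "sigma_finite_measure P" and I[measurable]: "I \<in> borel_measurable P"
  shows "(\<lambda>a. emeasure P {\<omega>\<in>space P. ennreal a < I \<omega>}) \<in> borel_measurable borel"
proof -
  interpret P: sigma_finite_measure P by fact
  have "emeasure P {\<omega>\<in>space P. ennreal a < I \<omega>} = (\<integral>\<^sup>+\<omega>. (if ennreal a < I \<omega> then 1 else 0) \<partial>P)" for a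
  proof -
    have "emeasure P {\<omega>\<in>space P. ennreal a < I \<omega>} = (\<integral>\<^sup>+\<omega>. indicator {\<omega>\<in>space P. ennreal a < I \<omega>} \<omega> \<partial>P)"
      by (simp add: nn_integral_indicator)
    also have "\<dots> = (\<integral>\<^sup>+\<omega>. (if ennreal a < I \<omega> then 1 else 0) \<partial>P)"
      by (intro nn_integral_cong) (auto simp: indicator_def)
    finally show ?thesis .
  qed
  then show ?thesis by simp
qed

lemma nn_integral_ennpowr:
  assumes "sigma_finite_measure P" and [measurable]: "I \<in> borel_measurable P" and p: "0 < p"
  shows "(\<integral>\<^sup>+\<omega>. I \<omega> ennpowr p \<partial>P)
    = (\<integral>\<^sup>+a. (if 0 < a then ennreal (p * a powr (p - 1)) * emeasure P {\<omega>\<in>space P. ennreal a < I \<omega>} else 0) \<partial>lborel)"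
  unfolding ennpowr_layer_cake[OF p] by (rule nn_integral_layer[OF assms(1)]) measurable

text \<open>Integrating over \<open>x\<close> first, at a fixed level \<open>a\<close>, replaces the
  weight \<open>p * x powr (p - 1)\<close> by \<open>C * p * a powr (p - 1)\<close> through
  \<open>gC\<close>. The layer-cake formula for \<open>I\<close> then reassembles its
  \<open>p\<close>-th moment.\<close>

lemma nn_integral_kernel_le:
  assumes P: "sigma_finite_measure P" and I[measurable]: "I \<in> borel_measurable P" and p: "0 < p"
    and g[measurable]: "case_prod g \<in> borel_measurable (borel \<Otimes>\<^sub>M borel)" and C: "0 \<le> C"
    and gC: "\<And>a. 0 < a \<Longrightarrow>
      (\<integral>\<^sup>+x. (if 0 < x then ennreal (x powr (p - 1)) * g x a else 0) \<partial>lborel) \<le> ennreal (C * a powr (p - 1))"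
  shows "(\<integral>\<^sup>+x. (if 0 < x then ennreal (p * x powr (p - 1)) *
        (\<integral>\<^sup>+\<omega>. (\<integral>\<^sup>+a. (if 0 < a \<and> ennreal a < I \<omega> then g x a else 0) \<partial>lborel) \<partial>P) else 0) \<partial>lborel)
    \<le> ennreal C * (\<integral>\<^sup>+\<omega>. I \<omega> ennpowr p \<partial>P)"
proof -
  define Q where "Q = (\<lambda>a. emeasure P {\<omega>\<in>space P. ennreal a < I \<omega>})"
  have [measurable]: "Q \<in> borel_measurable borel"
    unfolding Q_def by (rule measurable_emeasure_tail[OF P I])
  have "(\<integral>\<^sup>+x. (if 0 < x then ennreal (p * x powr (p - 1)) *
        (\<integral>\<^sup>+\<omega>. (\<integral>\<^sup>+a. (if 0 < a \<and> ennreal a < I \<omega> then g x a else 0) \<partial>lborel) \<partial>P) else 0) \<partial>lborel)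
    = (\<integral>\<^sup>+x. \<integral>\<^sup>+a. (if 0 < x \<and> 0 < a then ennreal (p * x powr (p - 1)) * (g x a * Q a) else 0) \<partial>lborel \<partial>lborel)"
  proof (rule nn_integral_cong)
    fix x :: real
    have [measurable]: "g x \<in> borel_measurable borel"
      using measurable_compose_Pair1[OF _ g, of x] by simp
    have "(\<integral>\<^sup>+\<omega>. (\<integral>\<^sup>+a. (if 0 < a \<and> ennreal a < I \<omega> then g x a else 0) \<partial>lborel) \<partial>P)
      = (\<integral>\<^sup>+a. (if 0 < a then g x a * Q a else 0) \<partial>lborel)"
      unfolding Q_def by (rule nn_integral_layer[OF P]) measurable
    moreover have "(\<integral>\<^sup>+a. (if 0 < a then ennreal (p * x powr (p - 1)) * (g x a * Q a) else 0) \<partial>lborel)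
      = (\<integral>\<^sup>+a. ennreal (p * x powr (p - 1)) * (if 0 < a then g x a * Q a else 0) \<partial>lborel)"
      by (intro nn_integral_cong) auto
    moreover have "\<dots> = ennreal (p * x powr (p - 1)) * (\<integral>\<^sup>+a. (if 0 < a then g x a * Q a else 0) \<partial>lborel)"
      by (rule nn_integral_cmult) measurable
    ultimately show "(if 0 < x then ennreal (p * x powr (p - 1)) *
        (\<integral>\<^sup>+\<omega>. (\<integral>\<^sup>+a. (if 0 < a \<and> ennreal a < I \<omega> then g x a else 0) \<partial>lborel) \<partial>P) else 0)
      = (\<integral>\<^sup>+a. (if 0 < x \<and> 0 < a then ennreal (p * x powr (p - 1)) * (g x a * Q a) else 0) \<partial>lborel)"
      by (cases "0 < x") simp_all
  qed
  also have "\<dots> = (\<integral>\<^sup>+a. \<integral>\<^sup>+x. (if 0 < x \<and> 0 < a then ennreal (p * x powr (p - 1)) * (g x a * Q a) else 0) \<partial>lborel \<partial>lborel)"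
    by (rule lborel_pair.Fubini'[symmetric]) measurable
  also have "\<dots> \<le> (\<integral>\<^sup>+a. ennreal C * (if 0 < a then ennreal (p * a powr (p - 1)) * Q a else 0) \<partial>lborel)"
  proof (rule nn_integral_mono)
    fix a :: real
    show "(\<integral>\<^sup>+x. (if 0 < x \<and> 0 < a then ennreal (p * x powr (p - 1)) * (g x a * Q a) else 0) \<partial>lborel)
      \<le> ennreal C * (if 0 < a then ennreal (p * a powr (p - 1)) * Q a else 0)"
    proof (cases "0 < a")
      case True
      have [measurable]: "(\<lambda>x. g x a) \<in> borel_measurable borel"
        using measurable_compose[OF measurable_Pair2', of a borel "case_prod g"] g by simp
      have "(\<integral>\<^sup>+x. (if 0 < x \<and> 0 < a then ennreal (p * x powr (p - 1)) * (g x a * Q a) else 0) \<partial>lborel)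
        = (\<integral>\<^sup>+x. (ennreal p * Q a) * (if 0 < x then ennreal (x powr (p - 1)) * g x a else 0) \<partial>lborel)"
        using True p by (intro nn_integral_cong) (simp add: ennreal_mult mult_ac)
      also have "\<dots> = (ennreal p * Q a) * (\<integral>\<^sup>+x. (if 0 < x then ennreal (x powr (p - 1)) * g x a else 0) \<partial>lborel)"
        by (rule nn_integral_cmult) measurable
      also have "\<dots> \<le> (ennreal p * Q a) * ennreal (C * a powr (p - 1))"
        by (intro mult_left_mono gC True) auto
      also have "\<dots> = ennreal C * (ennreal (p * a powr (p - 1)) * Q a)"
        using p C by (simp add: ennreal_mult mult_ac)
      finally show ?thesis using True by simp
    qed simp
  qed
  also have "\<dots> = ennreal C * (\<integral>\<^sup>+a. (if 0 < a then ennreal (p * a powr (p - 1)) * Q a else 0) \<partial>lborel)"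
    by (rule nn_integral_cmult) measurable
  finally show ?thesis unfolding nn_integral_ennpowr[OF P I p] Q_def .
qed

lemma ennreal_less_of_less_enn2real_min:
  assumes "0 < a" "a < enn2real (min y (ennreal b))"
  shows "ennreal a < y" "a < b"
proof -
  have "ennreal a < ennreal (enn2real (min y (ennreal b)))" using assms by (simp add: ennreal_less_iff)
  also have "\<dots> = min y (ennreal b)" by (rule ennreal_enn2real) (simp add: min_less_iff_disj)
  finally show "ennreal a < y" "a < b" using assms by (auto simp: ennreal_less_iff)
qed

context filtered_prob_space
begin

text \<open>The first bound removes the cutoff by letting \<open>b\<close> tend to infinity. The
  second takes \<open>b = x\<close> and pays for the excluded event \<open>I > x\<close> with one
  extra moment of \<open>I\<close>.\<close>

lemma moment_le_of_tail:
  assumes S[measurable]: "S \<in> borel_measurable P" and I[measurable]: "I \<in> borel_measurable P"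
    and tail: "\<And>x b. 0 < x \<Longrightarrow> 0 < b \<Longrightarrow> emeasure P {\<omega>\<in>space P. ennreal x < S \<omega> \<and> I \<omega> \<le> ennreal b}
       \<le> (\<integral>\<^sup>+\<omega>. ennreal (ln (x + enn2real (min (I \<omega>) (ennreal b))) - ln x) \<partial>P)"
    and p: "0 < p" "p < 1"
  shows "(\<integral>\<^sup>+\<omega>. S \<omega> ennpowr p \<partial>P) \<le> ennreal (pi / sin (pi * p)) * (\<integral>\<^sup>+\<omega>. I \<omega> ennpowr p \<partial>P)"
    and "(\<integral>\<^sup>+\<omega>. S \<omega> ennpowr p \<partial>P) \<le> ennreal (1 + 1 / (1 - p)) * (\<integral>\<^sup>+\<omega>. I \<omega> ennpowr p \<partial>P)"
proof -
  have sf: "sigma_finite_measure P" ..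
  have sinp: "0 < sin (pi * p)" using p by (intro sin_gt_zero) auto
  have tail': "emeasure P {\<omega>\<in>space P. ennreal x < S \<omega> \<and> I \<omega> \<le> ennreal b}
     \<le> (\<integral>\<^sup>+\<omega>. (\<integral>\<^sup>+a. (if 0 < a \<and> ennreal a < I \<omega> then (if a < b then ennreal (1 / (x + a)) else 0) else 0) \<partial>lborel) \<partial>P)"
    if "0 < x" "0 < b" for x b
  proof -
    have "(\<integral>\<^sup>+\<omega>. ennreal (ln (x + enn2real (min (I \<omega>) (ennreal b))) - ln x) \<partial>P)
      \<le> (\<integral>\<^sup>+\<omega>. (\<integral>\<^sup>+a. (if 0 < a \<and> ennreal a < I \<omega> then (if a < b then ennreal (1 / (x + a)) else 0) else 0) \<partial>lborel) \<partial>P)"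
      unfolding ln_increment_eq_nn_integral[OF that(1) enn2real_nonneg]
      by (intro nn_integral_mono) (auto dest: ennreal_less_of_less_enn2real_min)
    with tail[OF that] show ?thesis by (rule order_trans)
  qed
  show "(\<integral>\<^sup>+\<omega>. S \<omega> ennpowr p \<partial>P) \<le> ennreal (pi / sin (pi * p)) * (\<integral>\<^sup>+\<omega>. I \<omega> ennpowr p \<partial>P)"
  \<comment> \<open>If \<open>I\<close> is infinite with positive probability, the right side is
    infinite, its constant being positive. Otherwise the events \<open>I \<le> Suc n\<close> exhaust
    the space up to a null set.\<close>
  proof (cases "AE \<omega> in P. I \<omega> < \<infinity>")
    case False
    have "(\<integral>\<^sup>+\<omega>. I \<omega> ennpowr p \<partial>P) = \<infinity>"
    proof (rule ccontr)
      assume "(\<integral>\<^sup>+\<omega>. I \<omega> ennpowr p \<partial>P) \<noteq> \<infinity>"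
      then have "AE \<omega> in P. I \<omega> ennpowr p \<noteq> \<infinity>"
        by (intro nn_integral_PInf_AE) (auto simp: ennpowr_def)
      then have "AE \<omega> in P. I \<omega> < \<infinity>"
        by eventually_elim (auto simp: ennpowr_def less_top[symmetric] split: if_splits)
      with False show False by blast
    qed
    then show ?thesis using sinp by (simp add: ennreal_mult_top)
  next
    case True
    have tailI: "emeasure P {\<omega>\<in>space P. ennreal x < S \<omega>}
       \<le> (\<integral>\<^sup>+\<omega>. (\<integral>\<^sup>+a. (if 0 < a \<and> ennreal a < I \<omega> then ennreal (1 / (x + a)) else 0) \<partial>lborel) \<partial>P)"
      (is "_ \<le> ?R") if x: "0 < x" for x
    proof -
      define B where "B = (\<lambda>n. {\<omega>\<in>space P. ennreal x < S \<omega> \<and> I \<omega> \<le> ennreal (real (Suc n))})"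
      have [measurable]: "B n \<in> sets P" for n unfolding B_def by measurable
      have "emeasure P {\<omega>\<in>space P. ennreal x < S \<omega>} = emeasure P (\<Union>n. B n)"
      proof (rule emeasure_eq_AE)
        show "AE \<omega> in P. (\<omega> \<in> {\<omega>\<in>space P. ennreal x < S \<omega>}) = (\<omega> \<in> (\<Union>n. B n))"
          using True
        proof eventually_elim
          case (elim \<omega>)
          then obtain n where "I \<omega> < of_nat n" using ennreal_Ex_less_of_nat by auto
          then have "I \<omega> \<le> ennreal (real (Suc n))"
            by (simp add: ennreal_of_nat_eq_real_of_nat order_trans[OF less_imp_le] ennreal_leI)
          then show ?case unfolding B_def by auto
        qed
      qed measurable
      also have "\<dots> = (SUP n. emeasure P (B n))"
      proof (rule SUP_emeasure_incseq[symmetric])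
        show "incseq B"
          unfolding B_def by (intro incseq_SucI) (auto elim!: order_trans intro!: ennreal_leI)
      qed auto
      also have "\<dots> \<le> ?R"
      proof (rule SUP_least)
        fix n
        have "emeasure P (B n) \<le> (\<integral>\<^sup>+\<omega>. (\<integral>\<^sup>+a. (if 0 < a \<and> ennreal a < I \<omega> then
            (if a < real (Suc n) then ennreal (1 / (x + a)) else 0) else 0) \<partial>lborel) \<partial>P)"
          unfolding B_def by (rule tail'[OF x]) simp
        \<comment> \<open>Removing the cutoff \<open>a < Suc n\<close> only enlarges the integral,
          so the bound is uniform in \<open>n\<close>.\<close>
        also have "\<dots> \<le> ?R" by (intro nn_integral_mono) auto
        finally show "emeasure P (B n) \<le> ?R" .
      qed
      finally show ?thesis .
    qed
    have "(\<integral>\<^sup>+\<omega>. S \<omega> ennpowr p \<partial>P) \<le> (\<integral>\<^sup>+x. (if 0 < x then ennreal (p * x powr (p - 1)) *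
        (\<integral>\<^sup>+\<omega>. (\<integral>\<^sup>+a. (if 0 < a \<and> ennreal a < I \<omega> then ennreal (1 / (x + a)) else 0) \<partial>lborel) \<partial>P) else 0) \<partial>lborel)"
      unfolding nn_integral_ennpowr[OF sf S p(1)]
      using tailI by (intro nn_integral_mono) (auto intro!: mult_left_mono)
    also have "\<dots> \<le> ennreal (pi / sin (pi * p)) * (\<integral>\<^sup>+\<omega>. I \<omega> ennpowr p \<partial>P)"
    proof (rule nn_integral_kernel_le[OF sf I p(1)])
      fix a :: real assume a: "0 < a"
      have "(\<integral>\<^sup>+x. (if 0 < x then ennreal (x powr (p - 1)) * ennreal (1 / (x + a)) else 0) \<partial>lborel)
        = (\<integral>\<^sup>+x. (if 0 < x then ennreal (x powr (p - 1) / (x + a)) else 0) \<partial>lborel)"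
        using a by (intro nn_integral_cong) (auto simp flip: ennreal_mult)
      then show "(\<integral>\<^sup>+x. (if 0 < x then ennreal (x powr (p - 1)) * ennreal (1 / (x + a)) else 0) \<partial>lborel)
        \<le> ennreal (pi / sin (pi * p) * a powr (p - 1))"
        using nn_integral_powr_over_shift[OF p a] by simp
    qed (use sinp in \<open>auto\<close>)
    finally show ?thesis .
  qed
  \<comment> \<open>The tail bound for \<open>b = x\<close>. For a fixed level \<open>a\<close> the
    cutoff \<open>a < x\<close> restricts the kernel integral to \<open>x > a\<close>.\<close>
  define T where "T = (\<lambda>x. \<integral>\<^sup>+\<omega>. (\<integral>\<^sup>+a. (if 0 < a \<and> ennreal a < I \<omega> then
       (if a < x then ennreal (1 / (x + a)) else 0) else 0) \<partial>lborel) \<partial>P)"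
  interpret pair_sigma_finite P lborel ..
  have [measurable]: "T \<in> borel_measurable borel"
    unfolding T_def by measurable
  define Q where "Q = (\<lambda>a. emeasure P {\<omega>\<in>space P. ennreal a < I \<omega>})"
  have [measurable]: "Q \<in> borel_measurable borel"
    unfolding Q_def by (rule measurable_emeasure_tail[OF sf I])
  have "emeasure P {\<omega>\<in>space P. ennreal x < S \<omega>} \<le> Q x + T x" if x: "0 < x" for x
  proof -
    have "emeasure P {\<omega>\<in>space P. ennreal x < S \<omega>}
      \<le> emeasure P ({\<omega>\<in>space P. ennreal x < I \<omega>} \<union> {\<omega>\<in>space P. ennreal x < S \<omega> \<and> I \<omega> \<le> ennreal x})"
      by (intro emeasure_mono) (auto simp: not_less)
    also have "\<dots> \<le> Q x + emeasure P {\<omega>\<in>space P. ennreal x < S \<omega> \<and> I \<omega> \<le> ennreal x}"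
      unfolding Q_def by (intro emeasure_subadditive) measurable
    also have "\<dots> \<le> Q x + T x"
      unfolding T_def by (intro add_left_mono tail' x)
    finally show ?thesis .
  qed
  then have "(\<integral>\<^sup>+\<omega>. S \<omega> ennpowr p \<partial>P)
      \<le> (\<integral>\<^sup>+x. (if 0 < x then ennreal (p * x powr (p - 1)) * Q x else 0)
         + (if 0 < x then ennreal (p * x powr (p - 1)) * T x else 0) \<partial>lborel)"
    unfolding nn_integral_ennpowr[OF sf S p(1)]
    by (intro nn_integral_mono) (auto simp flip: distrib_left intro!: mult_left_mono)
  also have "\<dots> = (\<integral>\<^sup>+x. (if 0 < x then ennreal (p * x powr (p - 1)) * Q x else 0) \<partial>lborel)
       + (\<integral>\<^sup>+x. (if 0 < x then ennreal (p * x powr (p - 1)) * T x else 0) \<partial>lborel)"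
    by (rule nn_integral_add) measurable
  also have "(\<integral>\<^sup>+x. (if 0 < x then ennreal (p * x powr (p - 1)) * Q x else 0) \<partial>lborel)
      = (\<integral>\<^sup>+\<omega>. I \<omega> ennpowr p \<partial>P)"
    unfolding nn_integral_ennpowr[OF sf I p(1)] Q_def ..
  also have "(\<integral>\<^sup>+x. (if 0 < x then ennreal (p * x powr (p - 1)) * T x else 0) \<partial>lborel)
      \<le> ennreal (1 / (1 - p)) * (\<integral>\<^sup>+\<omega>. I \<omega> ennpowr p \<partial>P)"
    unfolding T_def
  proof (rule nn_integral_kernel_le[OF sf I p(1)])
    fix a :: real assume a: "0 < a"
    have "(\<integral>\<^sup>+x. (if 0 < x then ennreal (x powr (p - 1)) * (if a < x then ennreal (1 / (x + a)) else 0) else 0) \<partial>lborel)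
      = (\<integral>\<^sup>+x. (if a < x then ennreal (x powr (p - 1) / (x + a)) else 0) \<partial>lborel)"
      using a by (intro nn_integral_cong) (auto simp flip: ennreal_mult)
    then show "(\<integral>\<^sup>+x. (if 0 < x then ennreal (x powr (p - 1)) * (if a < x then ennreal (1 / (x + a)) else 0) else 0) \<partial>lborel)
      \<le> ennreal (1 / (1 - p) * a powr (p - 1))"
      using nn_integral_powr_over_shift_tail_le[OF p a] by simp
  qed (use p in auto)
  also have "(\<integral>\<^sup>+\<omega>. I \<omega> ennpowr p \<partial>P) + ennreal (1 / (1 - p)) * (\<integral>\<^sup>+\<omega>. I \<omega> ennpowr p \<partial>P)
     = ennreal (1 + 1 / (1 - p)) * (\<integral>\<^sup>+\<omega>. I \<omega> ennpowr p \<partial>P)"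
    using p by (subst ennreal_plus) (auto simp: distrib_right)
  finally show "(\<integral>\<^sup>+\<omega>. S \<omega> ennpowr p \<partial>P) \<le> ennreal (1 + 1 / (1 - p)) * (\<integral>\<^sup>+\<omega>. I \<omega> ennpowr p \<partial>P)"
    by (simp add: add_left_mono)
qed

end

section \<open>Measurable versions of the extrema and the conclusion\<close>

text \<open>By continuity, a value above the rational supremum would persist at a rational time
  shortly after \<open>t\<close>; a later time surely stays in \<open>{0..}\<close>.\<close>

lemma SUP_ennreal_Rats:
  fixes f :: "real \<Rightarrow> real"
  assumes f: "continuous_on {0..} f"
  shows "(SUP t\<in>\<rat> \<inter> {0..}. ennreal (f t)) = (SUP t\<in>{0..}. ennreal (f t))"
proof (rule antisym)
  show "(SUP t\<in>{0..}. ennreal (f t)) \<le> (SUP t\<in>\<rat> \<inter> {0..}. ennreal (f t))" (is "_ \<le> ?S")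
  proof (rule SUP_least, rule ccontr)
    fix t :: real assume t: "t \<in> {0..}" and "\<not> ennreal (f t) \<le> ?S"
    then have "?S < ennreal (f t)" by simp
    moreover have "((\<lambda>u. ennreal (f u)) \<longlongrightarrow> ennreal (f t)) (at t within {0..})"
      using f t by (intro tendsto_ennrealI) (auto simp: continuous_on_def)
    ultimately have "eventually (\<lambda>u. ?S < ennreal (f u)) (at t within {0..})"
      by (rule order_tendstoD(1)[rotated])
    then obtain d where d: "0 < d" "\<And>u. 0 \<le> u \<Longrightarrow> u \<noteq> t \<Longrightarrow> dist u t < d \<Longrightarrow> ?S < ennreal (f u)"
      by (auto simp: eventually_at)
    obtain q where q: "q \<in> \<rat>" "t < q" "q < t + d" using Rats_dense_in_real[of t "t + d"] d by auto
    have "?S < ennreal (f q)" using q t by (intro d(2)) (auto simp: dist_real_def)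
    moreover have "ennreal (f q) \<le> ?S" using q t by (intro SUP_upper) auto
    ultimately show False by simp
  qed
qed (rule SUP_subset_mono, auto)

text \<open>Truncation at 0 commutes with suprema. This links the extended real suprema of the
  theorem with the suprema in \<open>ennreal\<close> used above.\<close>

lemma e2ennreal_SUP_ereal:
  fixes f :: "'b \<Rightarrow> real"
  shows "e2ennreal (SUP t\<in>A. ereal (f t)) = (SUP t\<in>A. ennreal (f t))"
proof (rule antisym)
  have "(SUP t\<in>A. ereal (f t)) \<le> enn2ereal (SUP t\<in>A. ennreal (f t))"
  proof (rule SUP_least)
    fix t assume "t \<in> A"
    have "ereal (f t) \<le> enn2ereal (ennreal (f t))" by (simp add: ennreal.rep_eq)
    also have "\<dots> \<le> enn2ereal (SUP t\<in>A. ennreal (f t))"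
      using SUP_upper[OF \<open>t \<in> A\<close>, of "\<lambda>t. ennreal (f t)"] by (simp add: less_eq_ennreal.rep_eq)
    finally show "ereal (f t) \<le> enn2ereal (SUP t\<in>A. ennreal (f t))" .
  qed
  from e2ennreal_mono[OF this] show "e2ennreal (SUP t\<in>A. ereal (f t)) \<le> (SUP t\<in>A. ennreal (f t))" by simp
  show "(SUP t\<in>A. ennreal (f t)) \<le> e2ennreal (SUP t\<in>A. ereal (f t))"
  proof (rule SUP_least)
    fix t assume "t \<in> A"
    then have "e2ennreal (ereal (f t)) \<le> e2ennreal (SUP t\<in>A. ereal (f t))"
      by (intro e2ennreal_mono SUP_upper)
    then show "ennreal (f t) \<le> e2ennreal (SUP t\<in>A. ereal (f t))" by simp
  qed
qed

theorem proposition1: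
  fixes P :: "'a measure" and F :: "real \<Rightarrow> 'a measure"
    and M :: "real \<Rightarrow> 'a \<Rightarrow> real" and p :: real
  assumes "0 < p" and "p < 1"
    and "filtered_prob_space P F"
    and "continuous_local_martingale P F M"
    and "AE \<omega> in P. M 0 \<omega> = 0"
  shows "(\<integral>\<^sup>+ \<omega>. e2ennreal (SUP t\<in>{0..}. ereal (M t \<omega>)) ennpowr p \<partial>P)
       \<le> ennreal (c_const p) * (\<integral>\<^sup>+ \<omega>. e2ennreal (- (INF t\<in>{0..}. ereal (M t \<omega>))) ennpowr p \<partial>P)"
proof -
  interpret filtered_prob_space P F by fact
  have Mm: "M t \<in> borel_measurable P" if "0 \<le> t" for t
  proof -
    have "M t \<in> borel_measurable (F t)"
      using assms(4) that by (auto simp: continuous_local_martingale_def local_martingale_def)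
    then show ?thesis by (rule measurable_from_subalg[OF subalgebra_F[OF that]])
  qed
  have cM: "AE \<omega> in P. continuous_on {0..} (\<lambda>t. M t \<omega>)"
    using assms(4) by (auto simp: continuous_local_martingale_def)
  \<comment> \<open>Suprema over countably many times are measurable, and almost sure continuity
    makes them agree almost everywhere with those over all times.\<close>
  define S where "S = (\<lambda>\<omega>. SUP t\<in>\<rat> \<inter> {0..}. ennreal (M t \<omega>))"
  define I where "I = (\<lambda>\<omega>. SUP t\<in>\<rat> \<inter> {0..}. ennreal (- M t \<omega>))"
  have cnt: "countable (\<rat> \<inter> {0::real..})" by (rule countable_Int1) (rule countable_rat)
  have Sm: "S \<in> borel_measurable P" and Im: "I \<in> borel_measurable P"
    unfolding S_def I_def
    by (intro borel_measurable_SUP cnt measurable_compose[OF _ measurable_ennreal] borel_measurable_uminus Mm; simp)+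
  have SM: "AE \<omega> in P. S \<omega> = (SUP t\<in>{0..}. ennreal (M t \<omega>))"
    using cM unfolding S_def by eventually_elim (rule SUP_ennreal_Rats)
  have IM: "AE \<omega> in P. I \<omega> = (SUP t\<in>{0..}. ennreal (- M t \<omega>))"
    using cM unfolding I_def by eventually_elim (intro SUP_ennreal_Rats continuous_intros)
  have eS: "(\<integral>\<^sup>+ \<omega>. e2ennreal (SUP t\<in>{0..}. ereal (M t \<omega>)) ennpowr p \<partial>P) = (\<integral>\<^sup>+ \<omega>. S \<omega> ennpowr p \<partial>P)"
    using SM by (intro nn_integral_cong_AE) (auto simp: e2ennreal_SUP_ereal)
  have "- (INF t\<in>{0..}. ereal (M t \<omega>)) = (SUP t\<in>{0..}. ereal (- M t \<omega>))" for \<omega>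
    by (simp flip: ereal_SUP_uminus_eq)
  then have eI: "(\<integral>\<^sup>+ \<omega>. e2ennreal (- (INF t\<in>{0..}. ereal (M t \<omega>))) ennpowr p \<partial>P) = (\<integral>\<^sup>+ \<omega>. I \<omega> ennpowr p \<partial>P)"
    using IM by (intro nn_integral_cong_AE) (auto simp: e2ennreal_SUP_ereal)
  note bounds = moment_le_of_tail[OF Sm Im
      continuous_local_martingale_tail[OF assms(4,5) Sm SM Im IM] assms(1,2)]
  have sinp: "0 < sin (pi * p)" using assms(1,2) by (intro sin_gt_zero) auto
  show ?thesis
  proof (cases "1 / p \<le> 4")
    \<comment> \<open>Here the minimum in \<open>c_const p\<close> is \<open>1 / p\<close>, which
      cancels the factor \<open>p\<close>.\<close>
    case True
    then have "c_const p = pi / sin (pi * p)" using assms(1) by (simp add: c_const_def)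
    then show ?thesis using bounds(1) by (simp add: eS eI)
  next
    case False
    then have p4: "p < 1 / 4" using assms(1) by (simp add: field_simps)
    \<comment> \<open>For \<open>p < 1 / 4\<close> the second bound has a factor of at most 3, while
      \<open>c_const p\<close> is at least 4 because \<open>sin u \<le> u\<close>.\<close>
    have "1 / (1 - p) \<le> 2" using p4 by (simp add: field_simps)
    moreover have "1 \<le> pi * p / sin (pi * p)"
      using sin_x_le_x[of "pi * p"] sinp assms(1) by simp
    moreover have "c_const p = 4 * (pi * p / sin (pi * p))" using False by (simp add: c_const_def)
    ultimately have "1 + 1 / (1 - p) \<le> c_const p" by linarith
    then show ?thesis using bounds(2) unfolding eS eI
      by (meson ennreal_leI mult_right_mono order_trans zero_le)
  qed
qed

end
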